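(* Let $\mu,\nu$ satisfy the ball-mass assumption and let the cost $c$ satisfy the Lipschitz cost assumption (see context). Assume that $\pi\ll\mu\otimes\nu$ and that the density $t=\frac{d\pi}{d(\mu\otimes\nu)}$ satisfies $$|t(x',y')-t(x,y)|\le L\,(c(x,x')+c(y,y'))^l\qquad\text{for all }x,x',y,y'\in\mathcal{X}$$ for suitable constants $L,l>0$. Then there is a constant $M>0$, depending only on $t$, the cost $c$, and the measures $\mu$ and $\nu$, such that for all sufficiently small $\varepsilon>0$ and all $x\in\mathrm{spt}(\mu)$, $y\in\mathrm{spt}(\nu)$, $$|t^\varepsilon(x,y)-t(x,y)|\le M\,(\varepsilon\log(1/\varepsilon))^l,$$ and the same upper bound holds for $\|T^\varepsilon-T\|_{\mathrm{HS}}$.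
   Context: $(\mathcal{X},d)$ is a compact metric space, $\mathcal{P}(\mathcal{X})$ the set of Borel probability measures, $\mathrm{spt}$ denotes support, $B(x,r)=\{x':d(x,x')<r\}$, $\|\cdot\|_{\mathrm{HS}}$ is the Hilbert--Schmidt norm. $\mu,\nu\in\mathcal{P}(\mathcal{X})$ and $\pi$ is a probability measure on $\mathcal{X}\times\mathcal{X}$ with first marginal $\mu$ and second marginal $\nu$. Lipschitz cost assumption: $c:\mathcal{X}\times\mathcal{X}\to\mathbb{R}$ is continuous and symmetric, $c\ge0$, $c(x,x)=0$, and there is $\mathrm{Lip}(c)>0$ with $|c(x,y)-c(x',y)|\le\mathrm{Lip}(c)\,d(x,x')$ for all $x,x',y$. Ball-mass assumption: there are constants $C_\mu,\mathcal{D}_\mu,\delta_\mu>0$ with $\mu(B(x,\delta))\ge C_\mu\delta^{\mathcal{D}_\mu}$ for all $\delta\in(0,\delta_\mu]$, $x\in\mathrm{spt}(\mu)$; moreover $C_\mu\le1$ (and $\mathcal{D}_\mu$ is at most the dimension of the ambient space when $\mathcal{X}$ is a subset of a Euclidean space). Analogous constants $C_\nu,\mathcal{D}_\nu,\delta_\nu$ exist for $\nu$. Entropic transport kernel: for $\rho,\sigma\in\mathcal{P}(\mathcal{X})$ and $\varepsilon>0$, $k^\varepsilon_{\rho\sigma}(x,y)=\exp([\alpha(x)+\beta(y)-c(x,y)]/\varepsilon)$ on $\mathcal{X}\times\mathcal{X}$, where $\alpha,\beta\in C(\mathcal{X})$ maximize $\int\alpha\,d\rho+\int\beta\,d\sigma-\varepsilon\int[\exp((\alpha(x)+\beta(y)-c(x,y))/\varepsilon)-1]\,d(\rho\otimes\sigma)(x,y)$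 and satisfy, for all $x,y\in\mathcal{X}$, $\alpha(x)=-\varepsilon\log\int\exp([\beta(y')-c(x,y')]/\varepsilon)\,d\sigma(y')$ and $\beta(y)=-\varepsilon\log\int\exp([\alpha(x')-c(x',y)]/\varepsilon)\,d\rho(x')$. Such pairs exist and $\alpha(x)+\beta(y)$ does not depend on the choice, so $k^\varepsilon_{\rho\sigma}\in C(\mathcal{X}\times\mathcal{X})$ is well defined. Operators: $T:L^2(\mu)\to L^2(\nu)$ is the operator induced by $\pi$, characterized by $\int(Tu)v\,d\nu=\int u(x)v(y)\,d\pi(x,y)$. $t^\varepsilon(x,y)=\int k^\varepsilon_{\mu\mu}(x,x')\,k^\varepsilon_{\nu\nu}(y',y)\,d\pi(x',y')$ and $T^\varepsilon:L^2(\mu)\to L^2(\nu)$, $u\mapsto\int u(x)t^\varepsilon(x,\cdot)\,d\mu(x)$. *)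

theory Defs
  imports "HOL-Probability.Probability"
begin

definition borel_prob :: "'a::topological_space measure \<Rightarrow> bool" where
  "borel_prob M \<longleftrightarrow> prob_space M \<and> sets M = sets borel"

definition spt :: "'a::topological_space measure \<Rightarrow> 'a set" where
  "spt M = {x. \<forall>U. open U \<longrightarrow> x \<in> U \<longrightarrow> 0 < emeasure M U}"

definition coupling ::
  "'a::topological_space measure \<Rightarrow> 'a measure \<Rightarrow> ('a \<times> 'a) measure \<Rightarrow> bool" where
  "coupling \<mu> \<nu> \<pi> \<longleftrightarrow> borel_prob \<pi> \<and> distr \<pi> borel fst = \<mu> \<and> distr \<pi> borel snd = \<nu>"

definition lipschitz_cost :: "('a::metric_space \<Rightarrow> 'a \<Rightarrow> real) \<Rightarrow> bool" where
  "lipschitz_cost c \<longleftrightarrow>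
     continuous_on UNIV (\<lambda>(x, y). c x y) \<and>
     (\<forall>x y. c x y = c y x) \<and> (\<forall>x y. 0 \<le> c x y) \<and> (\<forall>x. c x x = 0) \<and>
     (\<exists>Lip>0. \<forall>x x' y. \<bar>c x y - c x' y\<bar> \<le> Lip * dist x x')"

definition ball_mass :: "'a::metric_space measure \<Rightarrow> bool" where
  "ball_mass M \<longleftrightarrow>
     (\<exists>C D \<delta>\<^sub>0. 0 < C \<and> C \<le> 1 \<and> 0 < D \<and> 0 < \<delta>\<^sub>0 \<and>
        (\<forall>\<delta>\<in>{0<..\<delta>\<^sub>0}. \<forall>x\<in>spt M. measure M (ball x \<delta>) \<ge> C * \<delta> powr D))"

subsection \<open>The entropic transport kernel\<close>

definition dual_objective ::
  "('a \<Rightarrow> 'a \<Rightarrow> real) \<Rightarrow> real \<Rightarrow> 'a measure \<Rightarrow> 'a measure \<Rightarrow> ('a \<Rightarrow> real) \<Rightarrow> ('a \<Rightarrow> real) \<Rightarrow> real" where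
  "dual_objective c \<epsilon> \<rho> \<sigma> \<alpha> \<beta> =
     (\<integral>x. \<alpha> x \<partial>\<rho>) + (\<integral>y. \<beta> y \<partial>\<sigma>)
       - \<epsilon> * (\<integral>(x, y). (exp ((\<alpha> x + \<beta> y - c x y) / \<epsilon>) - 1) \<partial>(\<rho> \<Otimes>\<^sub>M \<sigma>))"

definition entropic_potentials ::
  "('a::topological_space \<Rightarrow> 'a \<Rightarrow> real) \<Rightarrow> real \<Rightarrow> 'a measure \<Rightarrow> 'a measure
     \<Rightarrow> ('a \<Rightarrow> real) \<Rightarrow> ('a \<Rightarrow> real) \<Rightarrow> bool" where
  "entropic_potentials c \<epsilon> \<rho> \<sigma> \<alpha> \<beta> \<longleftrightarrow>
     continuous_on UNIV \<alpha> \<and> continuous_on UNIV \<beta> \<and>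
     (\<forall>\<alpha>' \<beta>'. continuous_on UNIV \<alpha>' \<longrightarrow> continuous_on UNIV \<beta>' \<longrightarrow>
        dual_objective c \<epsilon> \<rho> \<sigma> \<alpha>' \<beta>' \<le> dual_objective c \<epsilon> \<rho> \<sigma> \<alpha> \<beta>) \<and>
     (\<forall>x. \<alpha> x = - \<epsilon> * ln (\<integral>y. exp ((\<beta> y - c x y) / \<epsilon>) \<partial>\<sigma>)) \<and>
     (\<forall>y. \<beta> y = - \<epsilon> * ln (\<integral>x. exp ((\<alpha> x - c x y) / \<epsilon>) \<partial>\<rho>))"

text \<open>Potentials are unique only up to an additive constant, but \<open>\<alpha> x + \<beta> y\<close>, and hence the
  kernel, does not depend on the chosen pair.\<close>

definition entropic_kernel ::
  "('a::topological_space \<Rightarrow> 'a \<Rightarrow> real) \<Rightarrow> real \<Rightarrow> 'a measure \<Rightarrow> 'a measure \<Rightarrow> 'a \<Rightarrow> 'a \<Rightarrow> real" where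
  "entropic_kernel c \<epsilon> \<rho> \<sigma> =
     (let (\<alpha>, \<beta>) = (SOME (\<alpha>, \<beta>). entropic_potentials c \<epsilon> \<rho> \<sigma> \<alpha> \<beta>)
      in (\<lambda>x y. exp ((\<alpha> x + \<beta> y - c x y) / \<epsilon>)))"

subsection \<open>Operators between real \<open>L\<^sup>2\<close> spaces\<close>

text \<open>Elements of \<open>L\<^sup>2\<close> are represented by square-integrable functions, and operators act on
  representatives. Equality of classes is equality almost everywhere.\<close>

definition L2 :: "'a measure \<Rightarrow> ('a \<Rightarrow> real) set" where
  "L2 M = {u \<in> borel_measurable M. integrable M (\<lambda>x. (u x)\<^sup>2)}"

definition L2_inner :: "'a measure \<Rightarrow> ('a \<Rightarrow> real) \<Rightarrow> ('a \<Rightarrow> real) \<Rightarrow> real" where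
  "L2_inner M u v = (\<integral>x. u x * v x \<partial>M)"

definition L2_norm :: "'a measure \<Rightarrow> ('a \<Rightarrow> real) \<Rightarrow> real" where
  "L2_norm M u = sqrt (L2_inner M u u)"

definition L2_operator ::
  "'a measure \<Rightarrow> 'b measure \<Rightarrow> (('a \<Rightarrow> real) \<Rightarrow> 'b \<Rightarrow> real) \<Rightarrow> bool" where
  "L2_operator M N A \<longleftrightarrow>
     (\<forall>u\<in>L2 M. A u \<in> L2 N) \<and>
     (\<forall>u\<in>L2 M. \<forall>v\<in>L2 M. \<forall>a b.
        AE y in N. A (\<lambda>x. a * u x + b * v x) y = a * A u y + b * A v y) \<and>
     (\<exists>K. \<forall>u\<in>L2 M. L2_norm N (A u) \<le> K * L2_norm M u)"

definition L2_basis :: "'a measure \<Rightarrow> ('a \<Rightarrow> real) set \<Rightarrow> bool" where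
  "L2_basis M B \<longleftrightarrow>
     B \<subseteq> L2 M \<and>
     (\<forall>e\<in>B. \<forall>f\<in>B. L2_inner M e f = (if e = f then 1 else 0)) \<and>
     (\<forall>u\<in>L2 M. (\<forall>e\<in>B. L2_inner M u e = 0) \<longrightarrow> (AE x in M. u x = 0))"

text \<open>The Hilbert--Schmidt norm of a bounded operator does not depend on the orthonormal basis,
  so one is chosen. As the sum is \<open>0\<close> by convention when it diverges, \<open>hs_norm\<close> is meaningful
  only together with \<open>hilbert_schmidt\<close>.\<close>

definition chosen_basis :: "'a measure \<Rightarrow> ('a \<Rightarrow> real) set" where
  "chosen_basis M = (SOME B. L2_basis M B)"

definition hilbert_schmidt ::
  "'a measure \<Rightarrow> 'b measure \<Rightarrow> (('a \<Rightarrow> real) \<Rightarrow> 'b \<Rightarrow> real) \<Rightarrow> bool" where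
  "hilbert_schmidt M N A \<longleftrightarrow>
     L2_operator M N A \<and> (\<lambda>e. (L2_norm N (A e))\<^sup>2) summable_on chosen_basis M"

definition hs_norm ::
  "'a measure \<Rightarrow> 'b measure \<Rightarrow> (('a \<Rightarrow> real) \<Rightarrow> 'b \<Rightarrow> real) \<Rightarrow> real" where
  "hs_norm M N A = sqrt (\<Sum>\<^sub>\<infinity>e\<in>chosen_basis M. (L2_norm N (A e))\<^sup>2)"

subsection \<open>The transfer operator and its entropic regularisation\<close>

text \<open>The characterisation determines \<open>transfer_op \<mu> \<nu> \<pi> u\<close> up to \<open>\<nu>\<close>-null sets.\<close>

definition transfer_op ::
  "'a measure \<Rightarrow> 'a measure \<Rightarrow> ('a \<times> 'a) measure \<Rightarrow> ('a \<Rightarrow> real) \<Rightarrow> 'a \<Rightarrow> real" where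
  "transfer_op \<mu> \<nu> \<pi> u =
     (SOME w. w \<in> L2 \<nu> \<and> (\<forall>v\<in>L2 \<nu>. (\<integral>y. w y * v y \<partial>\<nu>) = (\<integral>(x, y). u x * v y \<partial>\<pi>)))"

definition entropic_density ::
  "('a::topological_space \<Rightarrow> 'a \<Rightarrow> real) \<Rightarrow> 'a measure \<Rightarrow> 'a measure \<Rightarrow> ('a \<times> 'a) measure
     \<Rightarrow> real \<Rightarrow> 'a \<Rightarrow> 'a \<Rightarrow> real" where
  "entropic_density c \<mu> \<nu> \<pi> \<epsilon> x y =
     (\<integral>(x', y'). entropic_kernel c \<epsilon> \<mu> \<mu> x x' * entropic_kernel c \<epsilon> \<nu> \<nu> y' y \<partial>\<pi>)"

definition entropic_transfer_op ::
  "('a::topological_space \<Rightarrow> 'a \<Rightarrow> real) \<Rightarrow> 'a measure \<Rightarrow> 'a measure \<Rightarrow> ('a \<times> 'a) measure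
     \<Rightarrow> real \<Rightarrow> ('a \<Rightarrow> real) \<Rightarrow> 'a \<Rightarrow> real" where
  "entropic_transfer_op c \<mu> \<nu> \<pi> \<epsilon> u y = (\<integral>x. u x * entropic_density c \<mu> \<nu> \<pi> \<epsilon> x y \<partial>\<mu>)"

end

theory Submission
  imports Defs
begin

text \<open>
  Because the kernels integrate to one, \<open>t\<^sup>\<epsilon> x y - t x y\<close> is the average of \<open>t x' y' - t x y\<close> with weight
  \<open>k\<^sub>\<mu>\<^sub>\<mu> x x' * k\<^sub>\<nu>\<^sub>\<nu> y' y\<close>. It is of order \<open>(\<epsilon> * ln (1 / \<epsilon>)) powr l\<close> as soon as the kernels put almost
  all of their mass where the cost is at most of order \<open>\<epsilon> * ln (1 / \<epsilon>)\<close> (\<open>smoothing_error\<close>).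

  This concentration comes from the ball-mass assumption. In a self-transport problem the two
  potentials can be taken equal, so the kernel is \<open>exp (g x + g y - c x y / \<epsilon>)\<close>. The function \<open>g\<close> inherits
  the Lipschitz constant of \<open>c / \<epsilon>\<close>, hence on the ball of radius \<open>\<epsilon>\<close> around \<open>x\<close> the kernel is at least
  a constant times its value at \<open>x\<close>. It integrates to at most one over this ball, whose mass is at least a power of \<open>\<epsilon>\<close>, so
  \<open>2 * g x\<close> is at most a multiple of \<open>ln (1 / \<epsilon>)\<close> (\<open>entropic_kernel_concentration\<close>). Where \<open>c x y\<close> exceeds a
  large multiple of \<open>\<epsilon> * ln (1 / \<epsilon>)\<close>, the kernel is then smaller than any prescribed power of \<open>\<epsilon>\<close>.

  The kernel is defined from an arbitrary pair of potentials, so existence and uniqueness up to a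
  constant have to be shown. Both follow from Birkhoff's argument: the map
  \<open>g \<mapsto> - ln (\<integral>y. exp (g y - c x y / \<epsilon>) \<partial>\<mu>)\<close> contracts the oscillation of differences
  (\<open>soft_transform_contraction\<close>). A fixed point of it is a solution of the Schroedinger equations, and
  by concavity it maximises the dual objective (\<open>dual_objective_maximal\<close>).

  For the operators, the transfer operator is the integral operator with kernel \<open>t\<close>, so the difference
  has kernel \<open>t\<^sup>\<epsilon> - t\<close>, which the pointwise estimate bounds almost everywhere. The Hilbert--Schmidt norm of
  an integral operator over probability measures is at most a bound of its kernel, by Bessel's
  inequality (\<open>hilbert_schmidt_bounded_kernel\<close>).
\<close>

section \<open>Supports, compactness and product measures\<close>

text \<open>By the Lindelof property the complement of the support is a countable union of open null
  sets.\<close>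

lemma AE_in_spt:
  fixes M :: "'a::second_countable_topology measure"
  assumes "sets M = sets borel"
  shows "AE x in M. x \<in> spt M"
proof -
  obtain \<F> where \<F>: "\<F> \<subseteq> {U. open U \<and> emeasure M U = 0}" "countable \<F>"
      "\<Union>\<F> = \<Union>{U. open U \<and> emeasure M U = 0}"
    using Lindelof[of "{U. open U \<and> emeasure M U = 0}"] by auto
  have "(\<Union>U\<in>\<F>. U) \<in> null_sets M"
    using \<F>(1) assms by (intro null_sets_UN' \<F>(2)) (auto simp: null_sets_def)
  then have "AE x in M. x \<notin> \<Union>\<F>"
    using AE_not_in by force
  then show ?thesis
    by eventually_elim (auto simp: \<F>(3) spt_def zero_less_iff_neq_zero)
qed

lemma closed_spt: "closed (spt M)"
proof -
  have "- spt M = \<Union>{U. open U \<and> emeasure M U = 0}"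
    by (auto simp: spt_def zero_less_iff_neq_zero)
  then show ?thesis
    by (auto simp: closed_def)
qed

lemma integrable_continuous_compact:
  fixes f :: "'a::topological_space \<Rightarrow> real"
  assumes "finite_measure M" and "sets M = sets borel"
    and "compact (UNIV :: 'a set)" "continuous_on UNIV f"
  shows "integrable M f"
proof -
  interpret finite_measure M by fact
  have "bounded (range f)"
    using compact_continuous_image[OF assms(4,3)] by (rule compact_imp_bounded)
  then obtain B where "\<forall>x. norm (f x) \<le> B"
    by (auto simp: bounded_iff)
  moreover have "f \<in> borel_measurable M"
    using borel_measurable_continuous_onI[OF assms(4)]
    unfolding measurable_cong_sets[OF assms(2) refl] .
  ultimately show ?thesis
    by (intro integrable_const_bound[of _ B]) auto
qed

lemma compact_UNIV_prod: "compact (UNIV :: 'a::topological_space set) \<Longrightarrow> compact (UNIV :: ('a \<times> 'a) set)"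
  using compact_Times[of "UNIV :: 'a set" "UNIV :: 'a set"] by simp

lemma sets_pair_borel:
  fixes M N :: "'a::second_countable_topology measure"
  assumes "sets M = sets borel" "sets N = sets borel"
  shows "sets (M \<Otimes>\<^sub>M N) = sets borel"
  unfolding borel_prod[symmetric] by (rule sets_pair_measure_cong[OF assms])

lemma pair_integrable_mult:
  fixes f :: "'a \<Rightarrow> real" and g :: "'b \<Rightarrow> real"
  assumes "prob_space M" "prob_space N" and f: "integrable M f" and g: "integrable N g"
  shows "integrable (M \<Otimes>\<^sub>M N) (\<lambda>(x, y). f x * g y)"
    and "(\<integral>(x, y). f x * g y \<partial>(M \<Otimes>\<^sub>M N)) = (\<integral>x. f x \<partial>M) * (\<integral>y. g y \<partial>N)"
proof -
  interpret M: prob_space M by fact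
  interpret N: prob_space N by fact
  interpret P: pair_prob_space M N ..
  show int: "integrable (M \<Otimes>\<^sub>M N) (\<lambda>(x, y). f x * g y)"
  proof (rule P.Fubini_integrable)
    show "(\<lambda>(x, y). f x * g y) \<in> borel_measurable (M \<Otimes>\<^sub>M N)"
      using f g by measurable
    have "integrable M (\<lambda>x. \<bar>f x\<bar> * (\<integral>y. \<bar>g y\<bar> \<partial>N))"
      using f by (intro integrable_mult_left) auto
    then show "integrable M (\<lambda>x. \<integral>y. norm (case (x, y) of (x, y) \<Rightarrow> f x * g y) \<partial>N)"
      by (simp add: abs_mult)
    show "AE x in M. integrable N (\<lambda>y. case (x, y) of (x, y) \<Rightarrow> f x * g y)"
      using g by auto
  qed
  show "(\<integral>(x, y). f x * g y \<partial>(M \<Otimes>\<^sub>M N)) = (\<integral>x. f x \<partial>M) * (\<integral>y. g y \<partial>N)"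
    using P.integral_fst'[OF int] by simp
qed

section \<open>Square-integrable functions\<close>

lemma L2_measurable: "u \<in> L2 M \<Longrightarrow> u \<in> borel_measurable M"
  by (simp add: L2_def)

lemma L2_mult_integrable:
  assumes "u \<in> L2 M" "v \<in> L2 M"
  shows "integrable M (\<lambda>x. u x * v x)"
proof (rule Bochner_Integration.integrable_bound)
  show "integrable M (\<lambda>x. (u x)\<^sup>2 + (v x)\<^sup>2)"
    using assms by (auto simp: L2_def)
  show "(\<lambda>x. u x * v x) \<in> borel_measurable M"
    using assms[THEN L2_measurable] by measurable
  have "\<bar>a * b\<bar> \<le> a\<^sup>2 + b\<^sup>2" for a b :: real
  proof -
    have "2 * (\<bar>a\<bar> * \<bar>b\<bar>) \<le> a\<^sup>2 + b\<^sup>2"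
      using sum_squares_bound[of "\<bar>a\<bar>" "\<bar>b\<bar>"] by simp
    moreover have "0 \<le> \<bar>a\<bar> * \<bar>b\<bar>"
      by simp
    ultimately show ?thesis
      unfolding abs_mult by linarith
  qed
  then show "AE x in M. norm (u x * v x) \<le> norm ((u x)\<^sup>2 + (v x)\<^sup>2)"
    by simp
qed

lemma L2_add: "u \<in> L2 M \<Longrightarrow> v \<in> L2 M \<Longrightarrow> (\<lambda>x. u x + v x) \<in> L2 M"
  using L2_mult_integrable[of u M v]
  by (auto simp: L2_def power2_sum mult.assoc)

lemma L2_scale: "u \<in> L2 M \<Longrightarrow> (\<lambda>x. a * u x) \<in> L2 M"
  by (auto simp: L2_def power_mult_distrib)

lemma L2_diff: "u \<in> L2 M \<Longrightarrow> v \<in> L2 M \<Longrightarrow> (\<lambda>x. u x - v x) \<in> L2 M"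
  using L2_add[of u M "\<lambda>x. -1 * v x"] L2_scale[of v M "-1"] by simp

lemma L2_sum: "(\<And>i. i \<in> I \<Longrightarrow> f i \<in> L2 M) \<Longrightarrow> (\<lambda>x. \<Sum>i\<in>I. f i x) \<in> L2 M"
proof (induction I rule: infinite_finite_induct)
  case (insert i I)
  then show ?case using L2_add[of "f i" M "\<lambda>x. \<Sum>i\<in>I. f i x"] by simp
qed (auto simp: L2_def)

lemma L2_inner_commute: "L2_inner M u v = L2_inner M v u"
  by (simp add: L2_inner_def mult.commute)

lemma L2_inner_scale_left: "L2_inner M (\<lambda>x. a * u x) v = a * L2_inner M u v"
  by (simp add: L2_inner_def mult.assoc)

lemma L2_inner_diff_left:
  "u \<in> L2 M \<Longrightarrow> v \<in> L2 M \<Longrightarrow> w \<in> L2 M \<Longrightarrow>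
    L2_inner M (\<lambda>x. u x - v x) w = L2_inner M u w - L2_inner M v w"
  by (simp add: L2_inner_def left_diff_distrib L2_mult_integrable)

lemma L2_inner_sum_left:
  "(\<And>i. i \<in> I \<Longrightarrow> f i \<in> L2 M) \<Longrightarrow> v \<in> L2 M \<Longrightarrow>
    L2_inner M (\<lambda>x. \<Sum>i\<in>I. f i x) v = (\<Sum>i\<in>I. L2_inner M (f i) v)"
  by (simp add: L2_inner_def sum_distrib_right L2_mult_integrable)

lemma L2_inner_self_nonneg: "0 \<le> L2_inner M u u"
  by (simp add: L2_inner_def)

lemma L2_norm_square: "(L2_norm M u)\<^sup>2 = L2_inner M u u"
  by (simp add: L2_norm_def L2_inner_self_nonneg)

lemma L2_inner_self_eq_0:
  assumes "u \<in> L2 M" "L2_inner M u u = 0"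
  shows "AE x in M. u x = 0"
  using assms integral_nonneg_eq_0_iff_AE[of M "\<lambda>x. u x * u x"] L2_mult_integrable[OF assms(1) assms(1)]
  by (auto simp: L2_inner_def)

lemma (in prob_space) bounded_in_L2:
  assumes "f \<in> borel_measurable M" "AE x in M. \<bar>f x\<bar> \<le> b"
  shows "f \<in> L2 M" "L2_inner M f f \<le> b\<^sup>2"
proof -
  have sq: "AE x in M. (f x)\<^sup>2 \<le> b\<^sup>2"
    using assms(2) by eventually_elim (simp add: abs_le_square_iff[symmetric])
  have "integrable M (\<lambda>x. (f x)\<^sup>2)"
    by (rule integrable_const_bound[of _ "b\<^sup>2"]) (use sq assms(1) in auto)
  then show "f \<in> L2 M"
    using assms(1) by (simp add: L2_def)
  have "(\<integral>x. (f x)\<^sup>2 \<partial>M) \<le> (\<integral>x. b\<^sup>2 \<partial>M)"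
    by (rule integral_mono_AE) (use sq \<open>integrable M (\<lambda>x. (f x)\<^sup>2)\<close> in auto)
  then show "L2_inner M f f \<le> b\<^sup>2"
    by (simp add: L2_inner_def power2_eq_square prob_space)
qed

lemma (in prob_space) L2_integrable: "u \<in> L2 M \<Longrightarrow> integrable M u"
  using L2_mult_integrable[of u M "\<lambda>_. 1"] bounded_in_L2(1)[of "\<lambda>_. 1" 1] by simp

text \<open>Expand \<open>0 \<le> \<parallel>f - (\<Sum>e\<in>F. \<langle>f, e\<rangle> e)\<parallel>\<^sup>2\<close>.\<close>

lemma Bessel_inequality:
  assumes "finite F" "F \<subseteq> L2 M" and f: "f \<in> L2 M"
    and on: "\<And>e e'. e \<in> F \<Longrightarrow> e' \<in> F \<Longrightarrow> L2_inner M e e' = (if e = e' then 1 else 0)"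
  shows "(\<Sum>e\<in>F. (L2_inner M e f)\<^sup>2) \<le> L2_inner M f f"
proof -
  define p where "p = (\<lambda>x. \<Sum>e\<in>F. L2_inner M e f * e x)"
  have eL: "e \<in> F \<Longrightarrow> e \<in> L2 M" for e
    using assms(2) by auto
  have p: "p \<in> L2 M"
    unfolding p_def by (intro L2_sum L2_scale eL)
  have p_inner: "L2_inner M p v = (\<Sum>e\<in>F. L2_inner M e f * L2_inner M e v)" if "v \<in> L2 M" for v
    unfolding p_def using that by (subst L2_inner_sum_left) (auto intro: L2_scale eL simp: L2_inner_scale_left)
  have pe: "L2_inner M e p = L2_inner M e f" if "e \<in> F" for e
  proof -
    have "L2_inner M e p = (\<Sum>e'\<in>F. L2_inner M e' f * L2_inner M e' e)"
      by (metis L2_inner_commute p_inner eL that)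
    also have "\<dots> = (\<Sum>e'\<in>F. if e' = e then L2_inner M e' f else 0)"
      by (intro sum.cong) (auto simp: on that)
    finally show ?thesis using that assms(1) by (simp add: sum.delta)
  qed
  have fp: "(\<lambda>x. f x - p x) \<in> L2 M"
    by (rule L2_diff[OF f p])
  have "0 \<le> L2_inner M (\<lambda>x. f x - p x) (\<lambda>x. f x - p x)"
    by (rule L2_inner_self_nonneg)
  also have "\<dots> = L2_inner M (\<lambda>x. f x - p x) f - L2_inner M (\<lambda>x. f x - p x) p"
    by (subst (1 2 3) L2_inner_commute) (rule L2_inner_diff_left[OF f p fp])
  also have "\<dots> = L2_inner M f f - 2 * L2_inner M p f + L2_inner M p p"
    using L2_inner_diff_left[OF f p f] L2_inner_diff_left[OF f p p] L2_inner_commute[of M f p]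
    by linarith
  also have "L2_inner M p p = (\<Sum>e\<in>F. (L2_inner M e f)\<^sup>2)"
    by (simp add: p_inner[OF p] pe power2_eq_square)
  also have "L2_inner M p f = (\<Sum>e\<in>F. (L2_inner M e f)\<^sup>2)"
    by (simp add: p_inner[OF f] power2_eq_square)
  finally show ?thesis by simp
qed

text \<open>By Zorn's lemma there is a maximal orthonormal family. A function orthogonal to all of it
  and not almost everywhere zero could be normalised and added to the family.\<close>

lemma L2_basis_exists: "\<exists>B. L2_basis M B"
proof -
  define ortho where "ortho B \<longleftrightarrow> B \<subseteq> L2 M \<and>
     (\<forall>e\<in>B. \<forall>f\<in>B. L2_inner M e f = (if e = f then 1 else 0))" for B
  have "\<exists>B\<in>Collect ortho. \<forall>B'\<in>Collect ortho. B \<subseteq> B' \<longrightarrow> B' = B"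
  proof (rule subset_Zorn)
    fix \<C> assume C: "subset.chain (Collect ortho) \<C>"
    have "ortho (\<Union>\<C>)"
      unfolding ortho_def
    proof (intro conjI ballI)
      show "\<Union>\<C> \<subseteq> L2 M"
        using C by (fastforce simp: subset_chain_def ortho_def)
      fix e f assume "e \<in> \<Union>\<C>" "f \<in> \<Union>\<C>"
      then obtain E F where "E \<in> \<C>" "F \<in> \<C>" "e \<in> E" "f \<in> F"
        by auto
      moreover from this have "E \<subseteq> F \<or> F \<subseteq> E"
        using C by (auto simp: subset_chain_def)
      ultimately obtain G where "G \<in> \<C>" "e \<in> G" "f \<in> G"
        by blast
      moreover from this have "ortho G"
        using C by (auto simp: subset_chain_def)
      ultimately show "L2_inner M e f = (if e = f then 1 else 0)"
        by (auto simp: ortho_def)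
    qed
    then show "\<exists>U\<in>Collect ortho. \<forall>X\<in>\<C>. X \<subseteq> U"
      by blast
  qed
  then obtain B where B: "ortho B" and max: "\<And>B'. ortho B' \<Longrightarrow> B \<subseteq> B' \<Longrightarrow> B' = B"
    by auto
  have "AE x in M. u x = 0" if u: "u \<in> L2 M" and perp: "\<forall>e\<in>B. L2_inner M u e = 0" for u
  proof (rule ccontr)
    assume "\<not> (AE x in M. u x = 0)"
    then have pos: "0 < L2_inner M u u"
      using L2_inner_self_eq_0[OF u] L2_inner_self_nonneg[of M u] by force
    define n where "n = sqrt (L2_inner M u u)"
    have n: "0 < n" "n * n = L2_inner M u u"
      using pos by (simp_all add: n_def)
    define w where "w = (\<lambda>x. inverse n * u x)"
    have w_inner: "L2_inner M w v = inverse n * L2_inner M u v" for v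
      unfolding w_def by (rule L2_inner_scale_left)
    have "L2_inner M w w = inverse n * (inverse n * (n * n))"
      by (simp add: w_inner L2_inner_commute[of M u w] n(2))
    then have ww: "L2_inner M w w = 1"
      using n(1) by (simp add: field_simps)
    have we: "L2_inner M w e = 0" if "e \<in> B" for e
      using perp that w_inner[of e] by simp
    have ew: "L2_inner M e w = 0" if "e \<in> B" for e
      using we[OF that] L2_inner_commute[of M e w] by simp
    have "w \<in> L2 M"
      unfolding w_def by (rule L2_scale[OF u])
    moreover have "w \<notin> B"
      using ww we[of w] by auto
    ultimately have "ortho (insert w B)"
      using B ww we ew unfolding ortho_def by auto
    with \<open>w \<notin> B\<close> max show False by blast
  qed
  then have "L2_basis M B"
    using B unfolding L2_basis_def ortho_def by blast
  then show ?thesis ..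
qed

section \<open>Integral operators with a bounded kernel\<close>

text \<open>The square of the Hilbert--Schmidt norm is a sum of \<open>\<parallel>A e\<parallel>\<^sup>2\<close> over an orthonormal basis. For
  fixed \<open>y\<close> the numbers \<open>A e y\<close> are the Fourier coefficients of the slice \<open>h (\<cdot>, y)\<close>, so by
  Bessel's inequality finite partial sums are at most \<open>\<integral> \<parallel>h (\<cdot>, y)\<parallel>\<^sup>2\<close>. This bounds the sum without
  knowing the basis to be countable.\<close>

lemma hilbert_schmidt_bounded_kernel:
  fixes h :: "'a \<Rightarrow> 'b \<Rightarrow> real"
  assumes "prob_space M" "prob_space N"
    and h: "(\<lambda>(x, y). h x y) \<in> borel_measurable (M \<Otimes>\<^sub>M N)"
    and hb: "AE y in N. AE x in M. \<bar>h x y\<bar> \<le> b" and "0 \<le> b"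
    and A: "\<And>u. u \<in> L2 M \<Longrightarrow> A u \<in> borel_measurable N"
      "\<And>u. u \<in> L2 M \<Longrightarrow> AE y in N. A u y = (\<integral>x. u x * h x y \<partial>M)"
  shows "hilbert_schmidt M N A" and "hs_norm M N A \<le> b"
proof -
  interpret M: prob_space M by fact
  interpret N: prob_space N by fact
  have slice: "AE y in N. (\<lambda>x. h x y) \<in> L2 M \<and> L2_inner M (\<lambda>x. h x y) (\<lambda>x. h x y) \<le> b\<^sup>2"
    using hb AE_space
  proof eventually_elim
    case (elim y)
    have "(\<lambda>x. h x y) \<in> borel_measurable M"
      using measurable_compose[OF measurable_Pair2'[OF elim(2)] h] by simp
    then show ?case
      using M.bounded_in_L2[OF _ elim(1)] by auto
  qed
  have bound1: "AE y in N. \<bar>A u y\<bar> \<le> b * L2_norm M u" if u: "u \<in> L2 M" for u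
    using A(2)[OF u] slice
  proof eventually_elim
    case (elim y)
    let ?h = "\<lambda>x. h x y"
    have "\<bar>L2_inner M u ?h\<bar> \<le> L2_norm M u * b"
    proof (cases "L2_inner M u u = 0")
      case True
      then have "AE x in M. u x * h x y = 0"
        using L2_inner_self_eq_0[OF u] by auto
      then have "L2_inner M u ?h = 0"
        unfolding L2_inner_def by (rule integral_eq_zero_AE)
      then show ?thesis
        using True \<open>0 \<le> b\<close> by (simp add: L2_norm_def)
    next
      case False
      define n where "n = L2_norm M u"
      have n: "0 < n" "n * n = L2_inner M u u"
        using False L2_inner_self_nonneg[of M u] by (auto simp: n_def L2_norm_def)
      define w where "w = (\<lambda>x. inverse n * u x)"
      have w: "L2_inner M w v = inverse n * L2_inner M u v" for v
        unfolding w_def by (rule L2_inner_scale_left)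
      have "w \<in> L2 M"
        unfolding w_def by (rule L2_scale[OF u])
      moreover have "L2_inner M w w = inverse n * (inverse n * (n * n))"
        by (simp add: w L2_inner_commute[of M u w] n(2))
      then have "L2_inner M w w = 1"
        using n(1) by (simp add: field_simps)
      ultimately have "(L2_inner M w ?h)\<^sup>2 \<le> b\<^sup>2"
        using Bessel_inequality[of "{w}" M ?h] elim(2) by auto
      then have "\<bar>L2_inner M w ?h\<bar> \<le> b"
        using \<open>0 \<le> b\<close> abs_le_square_iff[of "L2_inner M w ?h" b] by simp
      moreover have "L2_inner M u ?h = n * L2_inner M w ?h"
        using n(1) by (simp add: w)
      ultimately show ?thesis
        using n(1) by (simp add: abs_mult n_def[symmetric])
    qed
    then show ?case
      using elim(1) by (simp add: L2_inner_def mult.commute)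
  qed
  have AL2: "A u \<in> L2 N" and Anorm: "L2_norm N (A u) \<le> b * L2_norm M u" if "u \<in> L2 M" for u
  proof -
    show "A u \<in> L2 N"
      using N.bounded_in_L2(1)[OF A(1)[OF that] bound1[OF that]] .
    have "0 \<le> b * L2_norm M u"
      using \<open>0 \<le> b\<close> by (simp add: L2_norm_def L2_inner_self_nonneg)
    then show "L2_norm N (A u) \<le> b * L2_norm M u"
      using N.bounded_in_L2(2)[OF A(1)[OF that] bound1[OF that]]
      unfolding L2_norm_def[of N] by (rule real_le_lsqrt)
  qed
  have lin: "AE y in N. A (\<lambda>x. a * u x + b * v x) y = a * A u y + b * A v y"
    if u: "u \<in> L2 M" and v: "v \<in> L2 M" for u v a b
    using A(2)[OF u] A(2)[OF v] A(2)[OF L2_add[OF L2_scale[OF u] L2_scale[OF v]], of a b] slice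
  proof eventually_elim
    case (elim y)
    have "integrable M (\<lambda>x. u x * h x y)" "integrable M (\<lambda>x. v x * h x y)"
      using elim(4) L2_mult_integrable u v by auto
    then show ?case
      using elim(1-3) by (simp add: distrib_right mult.assoc)
  qed
  have op: "L2_operator M N A"
    unfolding L2_operator_def using AL2 lin Anorm by blast
  have B: "L2_basis M (chosen_basis M)"
    unfolding chosen_basis_def using L2_basis_exists by (rule someI_ex)
  have fin: "(\<Sum>e\<in>F. (L2_norm N (A e))\<^sup>2) \<le> b\<^sup>2" if F: "finite F" "F \<subseteq> chosen_basis M" for F
  proof -
    have F2: "F \<subseteq> L2 M" and on: "\<And>e e'. e \<in> F \<Longrightarrow> e' \<in> F \<Longrightarrow> L2_inner M e e' = (if e = e' then 1 else 0)"
      using B F(2) by (auto simp: L2_basis_def subset_iff)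
    have int: "integrable N (\<lambda>y. A e y * A e y)" if "e \<in> F" for e
      using AL2 F2 that L2_mult_integrable by blast
    have "(\<Sum>e\<in>F. (L2_norm N (A e))\<^sup>2) = (\<integral>y. (\<Sum>e\<in>F. A e y * A e y) \<partial>N)"
      using int by (simp add: L2_norm_square L2_inner_def)
    also have "\<dots> \<le> (\<integral>y. b\<^sup>2 \<partial>N)"
    proof (rule integral_mono_AE)
      show "integrable N (\<lambda>y. \<Sum>e\<in>F. A e y * A e y)"
        using int by auto
      have "AE y in N. \<forall>e\<in>F. A e y = (\<integral>x. e x * h x y \<partial>M)"
        using F2 by (intro AE_finite_allI F(1) A(2)) auto
      then show "AE y in N. (\<Sum>e\<in>F. A e y * A e y) \<le> b\<^sup>2"
        using slice
      proof eventually_elim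
        case (elim y)
        have "(\<Sum>e\<in>F. A e y * A e y) = (\<Sum>e\<in>F. (L2_inner M e (\<lambda>x. h x y))\<^sup>2)"
          using elim(1) by (intro sum.cong) (auto simp: L2_inner_def power2_eq_square)
        also have "\<dots> \<le> L2_inner M (\<lambda>x. h x y) (\<lambda>x. h x y)"
          using elim(2) by (intro Bessel_inequality F(1) F2 on) auto
        also have "\<dots> \<le> b\<^sup>2"
          using elim(2) by simp
        finally show ?case .
      qed
    qed simp
    finally show ?thesis
      by (simp add: N.prob_space)
  qed
  have summ: "(\<lambda>e. (L2_norm N (A e))\<^sup>2) summable_on chosen_basis M"
    using fin by (intro nonneg_bdd_above_summable_on bdd_aboveI2[where M = "b\<^sup>2"]) auto
  show "hilbert_schmidt M N A"
    unfolding hilbert_schmidt_def using op summ by blast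
  have "(\<Sum>\<^sub>\<infinity>e\<in>chosen_basis M. (L2_norm N (A e))\<^sup>2) \<le> b\<^sup>2"
    using summ fin by (rule infsum_le_finite_sums)
  then show "hs_norm M N A \<le> b"
    unfolding hs_norm_def using \<open>0 \<le> b\<close> by (intro real_le_lsqrt)
qed

section \<open>The soft transform and its fixed point\<close>

text \<open>The locale is used with \<open>\<kappa> = c / \<epsilon>\<close>. The constants \<open>K\<close> and \<open>\<Lambda>\<close> are then of order \<open>1 / \<epsilon>\<close>.\<close>

locale compact_cost = prob_space M
  for M :: "'a::{metric_space, second_countable_topology} measure" +
  fixes \<kappa> :: "'a \<Rightarrow> 'a \<Rightarrow> real" and K \<Lambda> :: real
  assumes compact_UNIV: "compact (UNIV :: 'a set)"
    and sets_M: "sets M = sets borel"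
    and cost_nonneg: "0 \<le> \<kappa> x y" and cost_le: "\<kappa> x y \<le> K"
    and cost_commute: "\<kappa> x y = \<kappa> y x"
    and cost_lipschitz: "\<bar>\<kappa> x y - \<kappa> x' y\<bar> \<le> \<Lambda> * dist x x'"
    and Lambda_nonneg: "0 \<le> \<Lambda>"
begin

text \<open>The potentials of a self-transport problem, divided by \<open>\<epsilon>\<close>, are exchanged by this map, so a
  fixed point of it is a symmetric pair of potentials.\<close>

definition soft_transform :: "('a \<Rightarrow> real) \<Rightarrow> 'a \<Rightarrow> real" where
  "soft_transform g x = - ln (\<integral>y. exp (g y - \<kappa> x y) \<partial>M)"

lemma continuous_of_lipschitz:
  fixes f :: "'a \<Rightarrow> real"
  assumes "\<And>x x'. \<bar>f x - f x'\<bar> \<le> \<Lambda> * dist x x'"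
  shows "continuous_on UNIV f"
  using assms Lambda_nonneg
  by (intro lipschitz_on_continuous_on[of \<Lambda>] lipschitz_onI) (auto simp: dist_real_def)

lemma continuous_cost: "continuous_on UNIV (\<kappa> x)"
  by (rule continuous_of_lipschitz) (metis cost_commute cost_lipschitz)

lemma continuous_integrable:
  fixes f :: "'a \<Rightarrow> real"
  assumes "continuous_on UNIV f"
  shows "integrable M f"
  by (intro integrable_continuous_compact finite_measure_axioms sets_M compact_UNIV assms)

lemma continuous_exponent: "continuous_on UNIV g \<Longrightarrow> continuous_on UNIV (\<lambda>y. exp (g y - \<kappa> x y))"
  by (intro continuous_intros continuous_cost)

lemma exp_integrable: "continuous_on UNIV g \<Longrightarrow> integrable M (\<lambda>y. exp (g y - \<kappa> x y))"
  by (intro continuous_integrable continuous_exponent)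

lemma partition_function_pos:
  assumes "continuous_on UNIV g"
  shows "0 < (\<integral>y. exp (g y - \<kappa> x y) \<partial>M)"
proof -
  have "0 \<le> (\<integral>y. exp (g y - \<kappa> x y) \<partial>M)"
    by simp
  moreover have "(\<integral>y. exp (g y - \<kappa> x y) \<partial>M) \<noteq> 0"
  proof
    assume "(\<integral>y. exp (g y - \<kappa> x y) \<partial>M) = 0"
    then have "AE y in M. exp (g y - \<kappa> x y) = 0"
      using integral_nonneg_eq_0_iff_AE[OF exp_integrable[OF assms]] by simp
    then show False by simp
  qed
  ultimately show ?thesis by linarith
qed

lemma exp_soft_transform:
  "continuous_on UNIV g \<Longrightarrow> exp (- soft_transform g x) = (\<integral>y. exp (g y - \<kappa> x y) \<partial>M)"
  by (simp add: soft_transform_def partition_function_pos)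

text \<open>This one comparison, with two points and two functions, contains monotonicity, the Lipschitz
  bound, the oscillation bound and non-expansiveness.\<close>

lemma soft_transform_shift:
  assumes g: "continuous_on UNIV g" and h: "continuous_on UNIV h"
    and le: "\<And>y. g y - \<kappa> x y \<le> h y - \<kappa> x' y + a"
  shows "soft_transform h x' \<le> soft_transform g x + a"
proof -
  have "(\<integral>y. exp (g y - \<kappa> x y) \<partial>M) \<le> (\<integral>y. exp a * exp (h y - \<kappa> x' y) \<partial>M)"
    using le by (intro integral_mono exp_integrable g integrable_mult_right h)
      (simp add: exp_add[symmetric] add.commute)
  then have "exp (- soft_transform g x) \<le> exp a * exp (- soft_transform h x')"
    by (simp add: exp_soft_transform g h)
  then show ?thesis
    by (simp flip: exp_add)
qed

lemma soft_transform_lipschitz: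
  assumes "continuous_on UNIV g"
  shows "\<bar>soft_transform g x - soft_transform g x'\<bar> \<le> \<Lambda> * dist x x'"
proof -
  have "soft_transform g x' \<le> soft_transform g x + \<Lambda> * dist x x'" for x x'
  proof (rule soft_transform_shift[OF assms assms])
    show "g y - \<kappa> x y \<le> g y - \<kappa> x' y + \<Lambda> * dist x x'" for y
      using cost_lipschitz[of x y x'] by linarith
  qed
  from this[of x x'] this[of x' x] show ?thesis
    by (simp add: dist_commute abs_le_iff)
qed

lemma continuous_soft_transform:
  "continuous_on UNIV g \<Longrightarrow> continuous_on UNIV (soft_transform g)"
  by (rule continuous_of_lipschitz) (rule soft_transform_lipschitz)

lemma soft_transform_oscillation:
  assumes "continuous_on UNIV g"
  shows "soft_transform g x - soft_transform g x' \<le> K"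
proof -
  have "soft_transform g x \<le> soft_transform g x' + K"
  proof (rule soft_transform_shift[OF assms assms])
    show "g y - \<kappa> x' y \<le> g y - \<kappa> x y + K" for y
      using cost_nonneg[of x' y] cost_le[of x y] by linarith
  qed
  then show ?thesis by simp
qed

lemma soft_transform_nonexpansive:
  assumes g: "continuous_on UNIV g" and h: "continuous_on UNIV h"
    and "\<And>y. \<bar>g y - h y\<bar> \<le> a"
  shows "\<bar>soft_transform g x - soft_transform h x\<bar> \<le> a"
proof -
  have le: "g y - h y \<le> a" "h y - g y \<le> a" for y
    using assms(3)[of y] by linarith+
  have "soft_transform h x \<le> soft_transform g x + a" "soft_transform g x \<le> soft_transform h x + a"
    using le by (intro soft_transform_shift g h; simp add: algebra_simps)+
  then show ?thesis by linarith
qed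

lemma soft_transform_add_const:
  assumes "continuous_on UNIV g"
  shows "soft_transform (\<lambda>y. g y + a) x = soft_transform g x - a"
proof -
  have "soft_transform (\<lambda>y. g y + a) x \<le> soft_transform g x + - a"
    "soft_transform g x \<le> soft_transform (\<lambda>y. g y + a) x + a"
    by (intro soft_transform_shift assms continuous_intros; simp)+
  then show ?thesis by linarith
qed

lemma K_nonneg: "0 \<le> K"
  using cost_nonneg cost_le order_trans by blast

text \<open>Birkhoff's contraction principle. Let \<open>P x\<close> be the probability measure with density
  proportional to \<open>exp (h - \<kappa> x)\<close>. Then \<open>soft_transform g - soft_transform h\<close> is \<open>- ln\<close> of the average
  of \<open>exp (g - h)\<close> under \<open>P x\<close>. As \<open>0 \<le> \<kappa> \<le> K\<close>, the measures for two points dominate each other up to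
  the factor \<open>exp (- 2 * K)\<close>, so this much of their mass cancels when the averages are compared. The
  remaining factor \<open>exp (- S)\<close> is the price of passing to logarithms.\<close>

lemma soft_transform_contraction:
  assumes g: "continuous_on UNIV g" and h: "continuous_on UNIV h"
    and osc: "\<And>y y'. (g y - h y) - (g y' - h y') \<le> s" and "s \<le> S"
  shows "(soft_transform g x - soft_transform h x) - (soft_transform g x' - soft_transform h x')
     \<le> (1 - exp (- 2 * K) * exp (- S)) * s"
proof -
  define \<eta> where "\<eta> = exp (- 2 * K)"
  have \<eta>: "0 < \<eta>" "\<eta> \<le> 1"
    using K_nonneg by (simp_all add: \<eta>_def)
  have "0 \<le> s"
    using osc[of x x] by simp
  obtain y0 where y0: "\<And>y. g y0 - h y0 \<le> g y - h y"
    using continuous_attains_inf[of "UNIV :: 'a set" "\<lambda>y. g y - h y"] compact_UNIV g h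
    by (auto intro: continuous_intros)
  define m where "m = g y0 - h y0"
  define Z where "Z = (\<lambda>x. \<integral>y. exp (h y - \<kappa> x y) \<partial>M)"
  define G where "G = (\<lambda>x. \<integral>y. exp (g y - \<kappa> x y) \<partial>M)"
  (* A x is the average of exp (g - h - m) under P x, which lies between 1 and exp s, and R x / Z x is
     the average of the nonnegative gap to exp s. The gaps for two points are compared. *)
  define A where "A = (\<lambda>x. exp (- m) * G x / Z x)"
  define R where "R = (\<lambda>x. \<integral>y. (exp s - exp (g y - h y - m)) * exp (h y - \<kappa> x y) \<partial>M)"
  have Z: "0 < Z x" and G: "0 < G x" for x
    unfolding Z_def G_def by (rule partition_function_pos[OF h] partition_function_pos[OF g])+
  have A_pos: "0 < A x" for x
    using Z G by (simp add: A_def)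
  have ln_A: "soft_transform g x - soft_transform h x = - (ln (A x) + m)" for x
  proof -
    have "soft_transform g x = - ln (G x)" "soft_transform h x = - ln (Z x)"
      by (simp_all add: soft_transform_def G_def Z_def)
    then show ?thesis
      using Z[of x] G[of x] by (simp add: A_def ln_div ln_mult)
  qed
  have R_eq: "R x = exp s * Z x - exp (- m) * G x" for x
  proof -
    have "R x = (\<integral>y. exp s * exp (h y - \<kappa> x y) - exp (- m) * exp (g y - \<kappa> x y) \<partial>M)"
      unfolding R_def by (intro Bochner_Integration.integral_cong)
        (simp_all add: left_diff_distrib exp_add[symmetric] algebra_simps)
    then show ?thesis
      using exp_integrable[OF g] exp_integrable[OF h] by (simp add: Z_def G_def)
  qed
  have W: "exp (g y - h y - m) \<le> exp s" for y
    using osc[of y y0] by (simp add: m_def)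
  have cont: "continuous_on UNIV (\<lambda>y. (exp s - exp (g y - h y - m)) * exp (h y - \<kappa> x y))" for x
    by (intro continuous_intros g h continuous_cost)
  have R_le: "exp (- K) * R x \<le> R x'"
  proof -
    have "exp (- K) * R x = (\<integral>y. exp (- K) * ((exp s - exp (g y - h y - m)) * exp (h y - \<kappa> x y)) \<partial>M)"
      unfolding R_def by simp
    also have "\<dots> \<le> R x'"
      unfolding R_def
    proof (intro integral_mono continuous_integrable cont continuous_on_mult_left)
      fix y
      have "exp (- K + (h y - \<kappa> x y)) \<le> exp (h y - \<kappa> x' y)"
        using cost_nonneg[of x y] cost_le[of x' y] by simp
      from mult_left_mono[OF this, of "exp s - exp (g y - h y - m)"]
      show "exp (- K) * ((exp s - exp (g y - h y - m)) * exp (h y - \<kappa> x y))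
          \<le> (exp s - exp (g y - h y - m)) * exp (h y - \<kappa> x' y)"
        using W[of y] by (simp only: exp_add) (simp add: mult_ac)
    qed
    finally show ?thesis .
  qed
  have R_nonneg: "0 \<le> R x" for x
    unfolding R_def using W by (intro Bochner_Integration.integral_nonneg) simp
  have Z_le: "Z x' \<le> exp K * Z x"
  proof -
    have "Z x' \<le> (\<integral>y. exp K * exp (h y - \<kappa> x y) \<partial>M)"
      unfolding Z_def
    proof (intro integral_mono exp_integrable h integrable_mult_right)
      show "exp (h y - \<kappa> x' y) \<le> exp K * exp (h y - \<kappa> x y)" for y
        using cost_nonneg[of x' y] cost_le[of x y] by (simp add: exp_add[symmetric])
    qed
    then show ?thesis by (simp add: Z_def)
  qed
  have "\<eta> * (exp s - A x) = (exp (- K) * R x) / (exp K * Z x)"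
    using Z[of x] by (simp add: R_eq A_def \<eta>_def field_simps exp_minus exp_add[symmetric])
  also have "\<dots> \<le> R x' / Z x'"
    by (intro frac_le R_le Z_le R_nonneg Z)
  also have "\<dots> = exp s - A x'"
    using Z[of x'] by (simp add: R_eq A_def field_simps)
  finally have A_le: "A x' \<le> (1 - \<eta>) * exp s + \<eta> * A x"
    by (simp add: algebra_simps)
  have "1 \<le> A x"
  proof -
    have "Z x \<le> (\<integral>y. exp (- m) * exp (g y - \<kappa> x y) \<partial>M)"
      unfolding Z_def
    proof (intro integral_mono exp_integrable g h integrable_mult_right)
      show "exp (h y - \<kappa> x y) \<le> exp (- m) * exp (g y - \<kappa> x y)" for y
        using y0[of y] by (simp add: m_def exp_add[symmetric])
    qed
    then show ?thesis
      using Z[of x] by (simp add: A_def G_def)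
  qed
  then have "(1 - \<eta>) * exp s * 1 \<le> (1 - \<eta>) * exp s * A x"
    using \<eta>(2) by (intro mult_left_mono) auto
  with A_le have "A x' \<le> ((1 - \<eta>) * exp s + \<eta>) * A x"
    by (simp add: algebra_simps)
  then have "A x' / A x \<le> (1 - \<eta>) * exp s + \<eta>"
    using A_pos[of x] by (simp add: divide_le_eq)
  also have "\<dots> = exp s * (1 - \<eta> * (1 - exp (- s)))"
    by (simp add: algebra_simps exp_minus)
  also have "\<dots> \<le> exp s * exp (- (\<eta> * (1 - exp (- s))))"
    using exp_ge_add_one_self[of "- (\<eta> * (1 - exp (- s)))"] by simp
  also have "\<dots> = exp (s - \<eta> * (1 - exp (- s)))"
    by (simp add: exp_add[symmetric])
  finally have "ln (A x' / A x) \<le> ln (exp (s - \<eta> * (1 - exp (- s))))"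
    using A_pos[of x] A_pos[of x'] by (subst ln_le_cancel_iff) auto
  then have "ln (A x' / A x) \<le> s - \<eta> * (1 - exp (- s))"
    by simp
  also have "\<dots> \<le> s - \<eta> * (exp (- S) * s)"
  proof -
    have "exp (- S) * s \<le> exp (- s) * s"
      using \<open>s \<le> S\<close> \<open>0 \<le> s\<close> by (simp add: mult_right_mono)
    also have "\<dots> \<le> exp (- s) * (exp s - 1)"
    proof (rule mult_left_mono)
      show "s \<le> exp s - 1"
        using exp_ge_add_one_self[of s] by linarith
    qed simp
    also have "\<dots> = 1 - exp (- s)"
      by (simp add: right_diff_distrib exp_add[symmetric])
    finally show ?thesis
      using \<eta>(1) by simp
  qed
  also have "ln (A x' / A x) = ln (A x') - ln (A x)"
    using A_pos[of x] A_pos[of x'] by (simp add: ln_div)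
  finally show ?thesis
    unfolding ln_A by (simp add: \<eta>_def algebra_simps)
qed

text \<open>Values of the transform oscillate by at most \<open>K\<close>, so the differences that occur below oscillate
  by at most \<open>2 * K\<close>. This is the choice of \<open>S\<close> in the contraction estimate.\<close>

definition contraction_rate :: real where
  "contraction_rate = 1 - exp (- 2 * K) * exp (- (2 * K))"

lemma contraction_rate: "0 \<le> contraction_rate" "contraction_rate < 1"
proof -
  have "exp (- 2 * K) * exp (- (2 * K)) \<le> 1 * 1"
    using K_nonneg by (intro mult_mono) auto
  then show "0 \<le> contraction_rate" "contraction_rate < 1"
    by (simp_all add: contraction_rate_def)
qed

lemma soft_transform_contraction_power:
  assumes "continuous_on UNIV g" "continuous_on UNIV h"
    and "\<And>y y'. (g y - h y) - (g y' - h y') \<le> contraction_rate ^ n * (2 * K)"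
  shows "(soft_transform g x - soft_transform h x) - (soft_transform g x' - soft_transform h x')
     \<le> contraction_rate ^ Suc n * (2 * K)"
proof -
  have "contraction_rate ^ n * (2 * K) \<le> 2 * K"
    using contraction_rate K_nonneg by (simp add: mult_left_le_one_le power_le_one)
  from soft_transform_contraction[OF assms this] show ?thesis
    by (simp add: contraction_rate_def mult.assoc)
qed

lemma eq_0_of_contraction_power_bound:
  assumes "\<And>n. \<bar>a\<bar> \<le> contraction_rate ^ n * b"
  shows "a = 0"
proof -
  have "(\<lambda>n. contraction_rate ^ n * b) \<longlonglongrightarrow> 0 * b"
    using contraction_rate by (intro tendsto_mult LIMSEQ_realpow_zero) auto
  then have "\<bar>a\<bar> \<le> 0 * b"
    by (rule LIMSEQ_le_const) (use assms in auto)
  then show ?thesis by simp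
qed

text \<open>The contraction only controls oscillations, so the Picard iterates are normalised to vanish at
  a point \<open>x0\<close>. Their limit is a fixed point up to an additive constant \<open>a\<close>, and since
  \<^term>\<open>soft_transform\<close> sends \<open>g + b\<close> to its value at \<open>g\<close> minus \<open>b\<close>, adding \<open>a / 2\<close> makes it exact.\<close>

lemma soft_transform_fixed_point:
  "\<exists>g. continuous_on UNIV g \<and> (\<forall>x. soft_transform g x = g x)"
proof -
  fix x0 :: 'a
  define N where "N = (\<lambda>g x. soft_transform g x - soft_transform g x0)"
  define G where "G = (\<lambda>n. (N ^^ n) (\<lambda>_. 0))"
  define r where "r = (\<lambda>n. contraction_rate ^ n * (2 * K))"
  have r: "r \<longlonglongrightarrow> 0"
    unfolding r_def using contraction_rate
    by (intro tendsto_mult_left_zero LIMSEQ_realpow_zero) auto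
  have G_Suc: "G (Suc n) = N (G n)" for n
    by (simp add: G_def)
  have G_cont: "continuous_on UNIV (G n)" for n
  proof (induction n)
    case (Suc n)
    then show ?case
      unfolding G_Suc N_def by (intro continuous_intros continuous_soft_transform)
  qed (simp add: G_def)
  have G_x0: "G n x0 = 0" for n
    by (cases n) (simp_all add: G_def N_def)
  have G_osc: "G n y - G n y' \<le> K" for n y y'
  proof (cases n)
    case 0
    then show ?thesis using K_nonneg by (simp add: G_def)
  next
    case (Suc m)
    then show ?thesis
      using soft_transform_oscillation[OF G_cont, of m y y'] by (simp add: G_Suc N_def)
  qed
  (* Compares the iterates started at 0 and at G p; all functions vanish at x0, so a bound on the
     oscillation is a bound in the uniform norm. *)
  have cauchy_osc: "(G (n + p) y - G n y) - (G (n + p) y' - G n y') \<le> r n" for n p y y'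
  proof (induction n arbitrary: y y')
    case 0
    show ?case
      using G_osc[of p y y'] K_nonneg by (simp add: r_def G_def)
  next
    case (Suc n)
    have G_diff: "G (Suc n + p) z - G (Suc n) z
        = soft_transform (G (n + p)) z - soft_transform (G n) z
          - (soft_transform (G (n + p)) x0 - soft_transform (G n) x0)" for z
      by (simp add: G_Suc N_def)
    show ?case
      using G_diff[of y] G_diff[of y']
        soft_transform_contraction_power[OF G_cont G_cont Suc[unfolded r_def], of y y']
      unfolding r_def by linarith
  qed
  have cauchy: "\<bar>G (n + p) y - G n y\<bar> \<le> r n" for n p y
    using cauchy_osc[of n p y x0] cauchy_osc[of n p x0 y] by (simp add: G_x0)
  have "\<exists>l. (\<lambda>n. G n y) \<longlonglongrightarrow> l" for y
  proof -
    have "Cauchy (\<lambda>n. G n y)"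
    proof (rule metric_CauchyI)
      fix e :: real assume "0 < e"
      then obtain n0 where n0: "r n0 < e / 2"
        using order_tendstoD(2)[OF r, of "e / 2"] by (auto simp: eventually_sequentially)
      have "dist (G m y) (G n y) < e" if "n0 \<le> m" "n0 \<le> n" for m n
        using cauchy[of n0 "m - n0" y] cauchy[of n0 "n - n0" y] n0 that
        by (simp add: dist_real_def)
      then show "\<exists>M. \<forall>m\<ge>M. \<forall>n\<ge>M. dist (G m y) (G n y) < e"
        by blast
    qed
    then show ?thesis
      by (simp add: Cauchy_convergent_iff convergent_def)
  qed
  then obtain g where g: "\<And>y. (\<lambda>n. G n y) \<longlonglongrightarrow> g y"
    by metis
  have g_close: "\<bar>g y - G n y\<bar> \<le> r n" for n y
  proof -
    have "(\<lambda>p. \<bar>G (n + p) y - G n y\<bar>) \<longlonglongrightarrow> \<bar>g y - G n y\<bar>"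
      using LIMSEQ_ignore_initial_segment[OF g, of n y]
      by (intro tendsto_intros) (simp add: add.commute[of n])
    then show ?thesis
      by (rule LIMSEQ_le_const2) (use cauchy in auto)
  qed
  have "uniform_limit UNIV G g sequentially"
    unfolding uniform_limit_iff
  proof (intro allI impI)
    fix e :: real assume "0 < e"
    then have "\<forall>\<^sub>F n in sequentially. r n < e"
      using order_tendstoD(2)[OF r] by auto
    then show "\<forall>\<^sub>F n in sequentially. \<forall>y\<in>UNIV. dist (G n y) (g y) < e"
    proof eventually_elim
      case (elim n)
      show ?case
      proof
        fix y
        show "dist (G n y) (g y) < e"
          using g_close[of y n] elim by (simp add: dist_real_def abs_minus_commute)
      qed
    qed
  qed
  then have g_cont: "continuous_on UNIV g"
    by (intro uniform_limit_theorem[of UNIV G sequentially]) (auto intro: G_cont always_eventually)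
  have N_fixed: "N g x - g x = 0" for x
  proof (rule eq_0_of_contraction_power_bound)
    fix n
    have step: "\<bar>soft_transform g z - soft_transform (G n) z\<bar> \<le> r n" for z
      by (intro soft_transform_nonexpansive g_cont G_cont g_close)
    have "r (Suc n) \<le> r n"
      unfolding r_def using contraction_rate K_nonneg
      by (intro mult_right_mono power_decreasing) auto
    moreover have "N g x - g x = (soft_transform g x - soft_transform (G n) x)
        - (soft_transform g x0 - soft_transform (G n) x0) - (g x - G (Suc n) x)"
      by (simp add: N_def G_Suc)
    ultimately have "\<bar>N g x - g x\<bar> \<le> 3 * r n"
      using step[of x] step[of x0] g_close[of x "Suc n"] by linarith
    then show "\<bar>N g x - g x\<bar> \<le> contraction_rate ^ n * (6 * K)"
      by (simp add: r_def)
  qed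
  have fixed: "soft_transform g x = g x + soft_transform g x0" for x
    using N_fixed[of x] unfolding N_def by linarith
  define a where "a = soft_transform g x0"
  have "soft_transform (\<lambda>y. g y + a / 2) x = g x + a / 2" for x
    using soft_transform_add_const[OF g_cont, of "a / 2" x] fixed[of x]
    unfolding a_def[symmetric] by linarith
  moreover have "continuous_on UNIV (\<lambda>y. g y + a / 2)"
    by (intro continuous_intros g_cont)
  ultimately show ?thesis
    by (intro exI[of _ "\<lambda>y. g y + a / 2"]) simp
qed

text \<open>The same contraction gives uniqueness: \<open>f\<close> and \<open>h\<close> are exchanged by the transform, which
  shrinks the oscillation of their difference.\<close>

lemma soft_transform_pair_differ_by_const:
  assumes f: "continuous_on UNIV f" and h: "continuous_on UNIV h"
    and fh: "\<And>x. f x = soft_transform h x" and hf: "\<And>x. h x = soft_transform f x"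
  obtains a where "\<And>x. f x = h x + a"
proof -
  have osc: "(f y - h y) - (f y' - h y') \<le> contraction_rate ^ n * (2 * K)" for n y y'
  proof (induction n arbitrary: y y')
    case 0
    show ?case
      using soft_transform_oscillation[OF h, of y y'] soft_transform_oscillation[OF f, of y' y]
      by (simp add: fh[symmetric] hf[symmetric])
  next
    case (Suc n)
    from soft_transform_contraction_power[OF f h Suc, of y' y] show ?case
      by (simp add: fh[symmetric] hf[symmetric])
  qed
  have "(f y - h y) - (f y' - h y') = 0" for y y'
    by (rule eq_0_of_contraction_power_bound[of _ "2 * K"])
      (use osc[of y y'] osc[of y' y] in \<open>simp add: abs_le_iff\<close>)
  from this[of _ undefined] have "f x = h x + (f undefined - h undefined)" for x
    by (metis add_diff_cancel_left' diff_add_cancel eq_iff_diff_eq_0)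
  then show ?thesis by (rule that)
qed

end

section \<open>Existence and form of the entropic kernel\<close>

text \<open>The dual objective is concave, and the two marginal conditions say that its derivative
  vanishes. Concretely, integrate \<open>exp z' \<ge> exp z + exp z * (z' - z)\<close>.\<close>

lemma dual_objective_maximal:
  fixes \<rho> \<sigma> :: "'a::{metric_space, second_countable_topology} measure"
  assumes comp: "compact (UNIV :: 'a set)" and "borel_prob \<rho>" "borel_prob \<sigma>" and \<epsilon>: "0 < \<epsilon>"
    and c: "continuous_on UNIV (\<lambda>(x, y). c x y)"
    and \<alpha>: "continuous_on UNIV \<alpha>" and \<beta>: "continuous_on UNIV \<beta>"
    and \<alpha>': "continuous_on UNIV \<alpha>'" and \<beta>': "continuous_on UNIV \<beta>'"
    and marg1: "\<And>x. (\<integral>y. exp ((\<alpha> x + \<beta> y - c x y) / \<epsilon>) \<partial>\<sigma>) = 1"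
    and marg2: "\<And>y. (\<integral>x. exp ((\<alpha> x + \<beta> y - c x y) / \<epsilon>) \<partial>\<rho>) = 1"
  shows "dual_objective c \<epsilon> \<rho> \<sigma> \<alpha>' \<beta>' \<le> dual_objective c \<epsilon> \<rho> \<sigma> \<alpha> \<beta>"
proof -
  interpret \<rho>: prob_space \<rho> using assms(2) by (simp add: borel_prob_def)
  interpret \<sigma>: prob_space \<sigma> using assms(3) by (simp add: borel_prob_def)
  interpret P: pair_prob_space \<rho> \<sigma> ..
  have sets: "sets \<rho> = sets borel" "sets \<sigma> = sets borel"
    using assms(2,3) by (simp_all add: borel_prob_def)
  have int: "integrable (\<rho> \<Otimes>\<^sub>M \<sigma>) f" if "continuous_on UNIV f" for f :: "'a \<times> 'a \<Rightarrow> real"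
    by (intro integrable_continuous_compact P.finite_measure_axioms sets_pair_borel sets compact_UNIV_prod comp that)
  have int1: "integrable \<rho> f" "integrable \<sigma> f" if "continuous_on UNIV f" for f :: "'a \<Rightarrow> real"
    by (intro integrable_continuous_compact \<rho>.finite_measure_axioms \<sigma>.finite_measure_axioms sets comp that)+
  define k where "k = (\<lambda>\<alpha> \<beta> (p :: 'a \<times> 'a). exp ((\<alpha> (fst p) + \<beta> (snd p) - c (fst p) (snd p)) / \<epsilon>))"
  have c': "continuous_on UNIV (\<lambda>p. c (fst p) (snd p))"
    using c by (simp add: case_prod_unfold)
  have comp1: "continuous_on UNIV (\<lambda>p :: 'a \<times> 'a. f (fst p))" "continuous_on UNIV (\<lambda>p :: 'a \<times> 'a. f (snd p))"
    if "continuous_on UNIV f" for f :: "'a \<Rightarrow> real"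
    using continuous_on_compose2[OF that continuous_on_fst[OF continuous_on_id], of UNIV]
      continuous_on_compose2[OF that continuous_on_snd[OF continuous_on_id], of UNIV] by simp_all
  have k_cont: "continuous_on UNIV (k f h)" if "continuous_on UNIV f" "continuous_on UNIV h" for f h
    unfolding k_def using that \<epsilon> by (intro continuous_intros comp1 c') auto
  have dual: "dual_objective c \<epsilon> \<rho> \<sigma> f h
      = (\<integral>x. f x \<partial>\<rho>) + (\<integral>y. h y \<partial>\<sigma>) - \<epsilon> * ((\<integral>p. k f h p \<partial>(\<rho> \<Otimes>\<^sub>M \<sigma>)) - 1)"
    if "continuous_on UNIV f" "continuous_on UNIV h" for f h
  proof -
    have "(\<integral>p. k f h p - 1 \<partial>(\<rho> \<Otimes>\<^sub>M \<sigma>)) = (\<integral>p. k f h p \<partial>(\<rho> \<Otimes>\<^sub>M \<sigma>)) - 1"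
      by (subst Bochner_Integration.integral_diff) (auto intro: int k_cont that simp: P.prob_space)
    then show ?thesis
      by (simp add: dual_objective_def k_def case_prod_unfold)
  qed
  have fst_marg: "(\<integral>p. k \<alpha> \<beta> p * f (fst p) \<partial>(\<rho> \<Otimes>\<^sub>M \<sigma>)) = (\<integral>x. f x \<partial>\<rho>)"
    if "continuous_on UNIV f" for f
  proof -
    have "integrable (\<rho> \<Otimes>\<^sub>M \<sigma>) (\<lambda>p. k \<alpha> \<beta> p * f (fst p))"
      by (intro int continuous_on_mult k_cont comp1 \<alpha> \<beta> that)
    from P.integral_fst'[OF this] show ?thesis
      by (simp add: k_def marg1)
  qed
  have snd_marg: "(\<integral>p. k \<alpha> \<beta> p * f (snd p) \<partial>(\<rho> \<Otimes>\<^sub>M \<sigma>)) = (\<integral>y. f y \<partial>\<sigma>)"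
    if "continuous_on UNIV f" for f
  proof -
    have "integrable (\<rho> \<Otimes>\<^sub>M \<sigma>) (\<lambda>(x, y). k \<alpha> \<beta> (x, y) * f y)"
      using int[OF continuous_on_mult[OF k_cont[OF \<alpha> \<beta>] comp1(2)[OF that]]]
      by (simp add: case_prod_unfold)
    from P.integral_snd[OF this] show ?thesis
      by (simp add: k_def marg2 case_prod_unfold)
  qed
  define D where "D = (\<lambda>p :: 'a \<times> 'a. (\<alpha>' (fst p) - \<alpha> (fst p)) + (\<beta>' (snd p) - \<beta> (snd p)))"
  have D_cont: "continuous_on UNIV D"
    unfolding D_def by (intro continuous_intros comp1 \<alpha> \<beta> \<alpha>' \<beta>')
  have tangent: "k \<alpha> \<beta> p + k \<alpha> \<beta> p * (D p / \<epsilon>) \<le> k \<alpha>' \<beta>' p" for p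
  proof -
    have "k \<alpha>' \<beta>' p = k \<alpha> \<beta> p * exp (D p / \<epsilon>)"
      by (simp add: k_def D_def exp_add[symmetric] add_divide_distrib[symmetric])
    moreover have "k \<alpha> \<beta> p * (1 + D p / \<epsilon>) \<le> k \<alpha> \<beta> p * exp (D p / \<epsilon>)"
      by (intro mult_left_mono exp_ge_add_one_self) (simp add: k_def)
    ultimately show ?thesis by (simp add: distrib_left)
  qed
  have kD: "(\<integral>p. k \<alpha> \<beta> p * D p \<partial>(\<rho> \<Otimes>\<^sub>M \<sigma>))
      = ((\<integral>x. \<alpha>' x \<partial>\<rho>) - (\<integral>x. \<alpha> x \<partial>\<rho>)) + ((\<integral>y. \<beta>' y \<partial>\<sigma>) - (\<integral>y. \<beta> y \<partial>\<sigma>))"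
  proof -
    have "(\<integral>p. k \<alpha> \<beta> p * D p \<partial>(\<rho> \<Otimes>\<^sub>M \<sigma>))
        = (\<integral>p. k \<alpha> \<beta> p * (\<lambda>x. \<alpha>' x - \<alpha> x) (fst p) + k \<alpha> \<beta> p * (\<lambda>y. \<beta>' y - \<beta> y) (snd p) \<partial>(\<rho> \<Otimes>\<^sub>M \<sigma>))"
      by (simp add: D_def distrib_left)
    also have "\<dots> = (\<integral>p. k \<alpha> \<beta> p * (\<lambda>x. \<alpha>' x - \<alpha> x) (fst p) \<partial>(\<rho> \<Otimes>\<^sub>M \<sigma>))
        + (\<integral>p. k \<alpha> \<beta> p * (\<lambda>y. \<beta>' y - \<beta> y) (snd p) \<partial>(\<rho> \<Otimes>\<^sub>M \<sigma>))"
      by (intro Bochner_Integration.integral_add int continuous_on_mult k_cont continuous_on_diff comp1 \<alpha> \<beta> \<alpha>' \<beta>')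
    also have "\<dots> = (\<integral>x. \<alpha>' x - \<alpha> x \<partial>\<rho>) + (\<integral>y. \<beta>' y - \<beta> y \<partial>\<sigma>)"
      by (subst fst_marg snd_marg, intro continuous_on_diff \<alpha> \<beta> \<alpha>' \<beta>')+ (rule refl)
    finally show ?thesis
      using int1 \<alpha> \<beta> \<alpha>' \<beta>' by simp
  qed
  have "(\<integral>p. k \<alpha> \<beta> p \<partial>(\<rho> \<Otimes>\<^sub>M \<sigma>)) + (\<integral>p. k \<alpha> \<beta> p * D p \<partial>(\<rho> \<Otimes>\<^sub>M \<sigma>)) / \<epsilon>
      = (\<integral>p. k \<alpha> \<beta> p + k \<alpha> \<beta> p * (D p / \<epsilon>) \<partial>(\<rho> \<Otimes>\<^sub>M \<sigma>))"
    using int[OF k_cont[OF \<alpha> \<beta>]] int[OF continuous_on_mult[OF k_cont[OF \<alpha> \<beta>] D_cont]]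
    by simp
  also have "\<dots> \<le> (\<integral>p. k \<alpha>' \<beta>' p \<partial>(\<rho> \<Otimes>\<^sub>M \<sigma>))"
    by (intro integral_mono int tangent continuous_on_add continuous_on_mult k_cont \<alpha> \<beta> \<alpha>' \<beta>'
        continuous_on_divide D_cont continuous_on_const) (use \<epsilon> in auto)
  finally have "\<epsilon> * (\<integral>p. k \<alpha> \<beta> p \<partial>(\<rho> \<Otimes>\<^sub>M \<sigma>)) + (\<integral>p. k \<alpha> \<beta> p * D p \<partial>(\<rho> \<Otimes>\<^sub>M \<sigma>))
      \<le> \<epsilon> * (\<integral>p. k \<alpha>' \<beta>' p \<partial>(\<rho> \<Otimes>\<^sub>M \<sigma>))"
    using \<epsilon> by (simp add: field_simps)
  then show ?thesis
    using \<alpha> \<beta> \<alpha>' \<beta>' by (simp add: dual kD right_diff_distrib)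
qed

context compact_cost
begin

lemma self_kernel_integral:
  assumes "continuous_on UNIV g" "\<And>x. soft_transform g x = g x"
  shows "(\<integral>y. exp (g x + g y - \<kappa> x y) \<partial>M) = 1"
proof -
  have "(\<integral>y. exp (g x + g y - \<kappa> x y) \<partial>M) = (\<integral>y. exp (g x) * exp (g y - \<kappa> x y) \<partial>M)"
    by (simp add: exp_add[symmetric] algebra_simps)
  also have "\<dots> = exp (g x) * exp (- soft_transform g x)"
    by (simp add: exp_soft_transform assms(1))
  finally show ?thesis
    by (simp add: assms(2) exp_add[symmetric])
qed

text \<open>On the ball the kernel is at least \<open>exp (- 2 * \<Lambda> * \<delta>)\<close> times its value \<open>exp (2 * g x)\<close> at the centre,
  because \<open>g\<close> and \<open>\<kappa> x\<close> are both \<open>\<Lambda>\<close>-Lipschitz. As the kernel integrates to one, the mass of the ball limits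
  the value at the centre.\<close>

lemma potential_le_ball_mass:
  assumes g: "continuous_on UNIV g" "\<And>x. soft_transform g x = g x"
    and "\<kappa> x x = 0" "0 < prob (ball x \<delta>)"
  shows "2 * g x \<le> 2 * \<Lambda> * \<delta> - ln (prob (ball x \<delta>))"
proof -
  have cont: "continuous_on UNIV (\<lambda>y. exp (g x + g y - \<kappa> x y))"
    by (intro continuous_intros g continuous_cost)
  have ball: "ball x \<delta> \<in> sets M"
    by (simp add: sets_M)
  have "exp (2 * g x - 2 * \<Lambda> * \<delta>) * prob (ball x \<delta>)
      = (\<integral>y. exp (2 * g x - 2 * \<Lambda> * \<delta>) * indicator (ball x \<delta>) y \<partial>M)"
    using ball by simp
  also have "\<dots> \<le> (\<integral>y. exp (g x + g y - \<kappa> x y) \<partial>M)"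
  proof (rule integral_mono)
    show "integrable M (\<lambda>y. exp (2 * g x - 2 * \<Lambda> * \<delta>) * indicator (ball x \<delta>) y)"
      using ball by (intro integrable_mult_right) (simp add: emeasure_eq_measure)
    show "integrable M (\<lambda>y. exp (g x + g y - \<kappa> x y))"
      by (rule continuous_integrable[OF cont])
    fix y
    show "exp (2 * g x - 2 * \<Lambda> * \<delta>) * indicator (ball x \<delta>) y \<le> exp (g x + g y - \<kappa> x y)"
    proof (cases "y \<in> ball x \<delta>")
      case True
      then have "\<Lambda> * dist x y \<le> \<Lambda> * \<delta>"
        using Lambda_nonneg by (intro mult_left_mono) auto
      moreover have "g x - g y \<le> \<Lambda> * dist x y"
        using soft_transform_lipschitz[OF g(1), of x y] by (simp add: g(2))
      moreover have "\<kappa> x y \<le> \<Lambda> * dist x y"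
        using cost_lipschitz[of y x x] \<open>\<kappa> x x = 0\<close> cost_commute[of x y] by (simp add: dist_commute)
      ultimately show ?thesis
        using True by simp
    qed simp
  qed
  also have "\<dots> = 1"
    by (rule self_kernel_integral[OF g])
  finally have "exp (2 * g x - 2 * \<Lambda> * \<delta> + ln (prob (ball x \<delta>))) \<le> exp 0"
    using assms(4) by (simp add: exp_add)
  then have "2 * g x - 2 * \<Lambda> * \<delta> + ln (prob (ball x \<delta>)) \<le> 0"
    by (simp only: exp_le_cancel_iff)
  then show ?thesis by simp
qed

end

text \<open>A fixed point of the soft transform for \<open>c / \<epsilon>\<close> yields one pair of potentials. Any other pair
  can be shifted by opposite constants to become symmetric, which does not change the kernel.\<close>

lemma entropic_kernel_symmetric_form:
  fixes M :: "'a::{metric_space, second_countable_topology} measure"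
  assumes "compact_cost M (\<lambda>x y. c x y / \<epsilon>) K \<Lambda>" and \<epsilon>: "0 < \<epsilon>"
    and c: "continuous_on UNIV (\<lambda>(x, y). c x y)"
  obtains g where "continuous_on UNIV g"
    "\<And>x. compact_cost.soft_transform M (\<lambda>x y. c x y / \<epsilon>) g x = g x"
    "entropic_kernel c \<epsilon> M M = (\<lambda>x y. exp (g x + g y - c x y / \<epsilon>))"
proof -
  interpret compact_cost M "\<lambda>x y. c x y / \<epsilon>" K \<Lambda> by fact
  have c_commute: "c x y = c y x" for x y
    using cost_commute[of x y] \<epsilon> by simp
  have bp: "borel_prob M"
    using sets_M prob_space_axioms by (simp add: borel_prob_def)
  have soft: "- \<epsilon> * ln (\<integral>y. exp ((f y - c x y) / \<epsilon>) \<partial>M) = \<epsilon> * soft_transform (\<lambda>y. f y / \<epsilon>) x" for f x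
    by (simp add: soft_transform_def diff_divide_distrib)
  have soft': "- \<epsilon> * ln (\<integral>x. exp ((f x - c x y) / \<epsilon>) \<partial>M) = \<epsilon> * soft_transform (\<lambda>y. f y / \<epsilon>) y" for f y
    using soft[of f y] unfolding c_commute[of y] .
  obtain g0 where g0: "continuous_on UNIV g0" "\<And>x. soft_transform g0 x = g0 x"
    using soft_transform_fixed_point by blast
  have marg: "(\<integral>y. exp ((\<epsilon> * g0 x + \<epsilon> * g0 y - c x y) / \<epsilon>) \<partial>M) = 1" for x
  proof -
    have "(\<epsilon> * g0 x + \<epsilon> * g0 y - c x y) / \<epsilon> = g0 x + g0 y - c x y / \<epsilon>" for y
      using \<epsilon> by (simp add: field_simps)
    then show ?thesis
      using self_kernel_integral[OF g0] by simp
  qed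
  have marg': "(\<integral>x. exp ((\<epsilon> * g0 x + \<epsilon> * g0 y - c x y) / \<epsilon>) \<partial>M) = 1" for y
    using marg[of y] unfolding c_commute[of y] add.commute[of "\<epsilon> * g0 y"] .
  have "entropic_potentials c \<epsilon> M M (\<lambda>x. \<epsilon> * g0 x) (\<lambda>x. \<epsilon> * g0 x)"
    unfolding entropic_potentials_def
  proof (intro conjI allI impI)
    show "continuous_on UNIV (\<lambda>x. \<epsilon> * g0 x)" "continuous_on UNIV (\<lambda>x. \<epsilon> * g0 x)"
      by (intro continuous_intros g0)+
    show "dual_objective c \<epsilon> M M \<alpha>' \<beta>' \<le> dual_objective c \<epsilon> M M (\<lambda>x. \<epsilon> * g0 x) (\<lambda>x. \<epsilon> * g0 x)"
      if "continuous_on UNIV \<alpha>'" "continuous_on UNIV \<beta>'" for \<alpha>' \<beta>'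
      by (intro dual_objective_maximal compact_UNIV bp \<epsilon> c that marg marg' continuous_intros g0)
    show "\<epsilon> * g0 x = - \<epsilon> * ln (\<integral>y. exp ((\<epsilon> * g0 y - c x y) / \<epsilon>) \<partial>M)" for x
      using \<epsilon> by (subst soft) (simp add: g0)
    show "\<epsilon> * g0 y = - \<epsilon> * ln (\<integral>x. exp ((\<epsilon> * g0 x - c x y) / \<epsilon>) \<partial>M)" for y
      using \<epsilon> by (subst soft') (simp add: g0)
  qed
  then have ex: "\<exists>p. case p of (\<alpha>, \<beta>) \<Rightarrow> entropic_potentials c \<epsilon> M M \<alpha> \<beta>"
    by blast
  obtain \<alpha> \<beta> where some: "(SOME (\<alpha>, \<beta>). entropic_potentials c \<epsilon> M M \<alpha> \<beta>) = (\<alpha>, \<beta>)"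
    by fastforce
  have pot: "entropic_potentials c \<epsilon> M M \<alpha> \<beta>"
    using someI_ex[OF ex] unfolding some by simp
  have \<alpha>: "continuous_on UNIV \<alpha>" and \<beta>: "continuous_on UNIV \<beta>"
    and schroedinger: "\<And>x. \<alpha> x = - \<epsilon> * ln (\<integral>y. exp ((\<beta> y - c x y) / \<epsilon>) \<partial>M)"
      "\<And>y. \<beta> y = - \<epsilon> * ln (\<integral>x. exp ((\<alpha> x - c x y) / \<epsilon>) \<partial>M)"
    using pot unfolding entropic_potentials_def by blast+
  define f where "f = (\<lambda>x. \<alpha> x / \<epsilon>)"
  define h where "h = (\<lambda>x. \<beta> x / \<epsilon>)"
  have f: "continuous_on UNIV f" and h: "continuous_on UNIV h"
    unfolding f_def h_def using \<alpha> \<beta> \<epsilon> by (intro continuous_intros; simp)+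
  have fh: "f x = soft_transform h x" for x
    using schroedinger(1)[of x] \<epsilon> unfolding soft f_def h_def by (simp only: field_simps)
  have hf: "h x = soft_transform f x" for x
    using schroedinger(2)[of x] \<epsilon> unfolding soft' f_def h_def by (simp only: field_simps)
  obtain a where a: "\<And>x. f x = h x + a"
    using soft_transform_pair_differ_by_const[OF f h fh hf] by blast
  define g where "g = (\<lambda>x. h x + a / 2)"
  have "continuous_on UNIV g"
    unfolding g_def by (intro continuous_intros h)
  moreover have "soft_transform g x = g x" for x
    using soft_transform_add_const[OF h, of "a / 2" x] fh[of x] a[of x]
    by (simp add: g_def)
  moreover have "entropic_kernel c \<epsilon> M M = (\<lambda>x y. exp (g x + g y - c x y / \<epsilon>))"
  proof (intro ext)
    fix x y
    have "(\<alpha> x + \<beta> y - c x y) / \<epsilon> = f x + h y - c x y / \<epsilon>"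
      by (simp add: f_def h_def add_divide_distrib diff_divide_distrib)
    also have "\<dots> = g x + g y - c x y / \<epsilon>"
      using a[of x] by (simp add: g_def)
    finally show "entropic_kernel c \<epsilon> M M x y = exp (g x + g y - c x y / \<epsilon>)"
      by (simp add: entropic_kernel_def some)
  qed
  ultimately show ?thesis by (rule that)
qed

section \<open>Concentration of the entropic kernel near the diagonal\<close>

definition concentrated_kernel ::
  "'a::metric_space measure \<Rightarrow> ('a \<Rightarrow> 'a \<Rightarrow> real) \<Rightarrow> real \<Rightarrow> real \<Rightarrow> ('a \<Rightarrow> 'a \<Rightarrow> real) \<Rightarrow> bool" where
  "concentrated_kernel M c \<epsilon> A k \<longleftrightarrow>
     continuous_on UNIV (\<lambda>(x, y). k x y) \<and>
     (\<forall>x y. 0 \<le> k x y) \<and> (\<forall>x y. k x y = k y x) \<and> (\<forall>x. (\<integral>y. k x y \<partial>M) = 1) \<and>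
     (\<forall>x\<in>spt M. \<forall>y\<in>spt M. k x y \<le> exp (A * ln (1 / \<epsilon>) - c x y / \<epsilon>))"

lemma concentrated_kernelD:
  assumes "concentrated_kernel M c \<epsilon> A k"
  shows "continuous_on UNIV (\<lambda>(x, y). k x y)" "continuous_on UNIV (k x)" "0 \<le> k x y" "k x y = k y x"
    "(\<integral>y. k x y \<partial>M) = 1"
    "x \<in> spt M \<Longrightarrow> y \<in> spt M \<Longrightarrow> k x y \<le> exp (A * ln (1 / \<epsilon>) - c x y / \<epsilon>)"
proof -
  show cont: "continuous_on UNIV (\<lambda>(x, y). k x y)"
    using assms by (simp add: concentrated_kernel_def)
  show "continuous_on UNIV (k x)"
    using continuous_on_compose2[OF cont, of UNIV "\<lambda>y. (x, y)"] by (simp add: continuous_intros)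
  show "0 \<le> k x y" "k x y = k y x" "(\<integral>y. k x y \<partial>M) = 1"
    "x \<in> spt M \<Longrightarrow> y \<in> spt M \<Longrightarrow> k x y \<le> exp (A * ln (1 / \<epsilon>) - c x y / \<epsilon>)"
    using assms unfolding concentrated_kernel_def by blast+
qed

lemma concentrated_kernel_mono:
  assumes "concentrated_kernel M c \<epsilon> A k" "A \<le> A'" "0 \<le> ln (1 / \<epsilon>)"
  shows "concentrated_kernel M c \<epsilon> A' k"
proof -
  have "exp (A * ln (1 / \<epsilon>) - d) \<le> exp (A' * ln (1 / \<epsilon>) - d)" for d
    using mult_right_mono[OF assms(2,3)] by simp
  with assms(1) show ?thesis
    unfolding concentrated_kernel_def by (meson order_trans)
qed

text \<open>In \<open>k x y = exp (g x + g y - c x y / \<epsilon>)\<close> the potential satisfies \<open>2 * g x \<le> A * ln (1 / \<epsilon>)\<close> on the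
  support, by the mass bound for the ball of radius \<open>\<epsilon>\<close>. The symmetric form matters here: it turns the
  bound on the diagonal into one for all pairs of points.\<close>

lemma entropic_kernel_concentration:
  fixes M :: "'a::{metric_space, second_countable_topology} measure"
  assumes comp: "compact (UNIV :: 'a set)" and bp: "borel_prob M" and bm: "ball_mass M"
    and lc: "lipschitz_cost c"
  shows "\<exists>A>0. \<forall>\<^sub>F \<epsilon> in at_right 0. concentrated_kernel M c \<epsilon> A (entropic_kernel c \<epsilon> M M)"
proof -
  interpret prob_space M using bp by (simp add: borel_prob_def)
  obtain Lip where c_cont: "continuous_on UNIV (\<lambda>(x, y). c x y)"
    and c_commute: "\<And>x y. c x y = c y x" and c_nonneg: "\<And>x y. 0 \<le> c x y"
    and c_refl: "\<And>x. c x x = 0" and Lip: "0 < Lip" "\<And>x x' y. \<bar>c x y - c x' y\<bar> \<le> Lip * dist x x'"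
    using lc unfolding lipschitz_cost_def by auto
  obtain C D \<delta>\<^sub>0 where C: "0 < C" "C \<le> 1" and D: "0 < D" and \<delta>\<^sub>0: "0 < \<delta>\<^sub>0"
    and mass: "\<And>\<delta> x. 0 < \<delta> \<Longrightarrow> \<delta> \<le> \<delta>\<^sub>0 \<Longrightarrow> x \<in> spt M \<Longrightarrow> C * \<delta> powr D \<le> prob (ball x \<delta>)"
    using bm unfolding ball_mass_def by auto
  have "bounded (range (\<lambda>(x, y). c x y))"
    using compact_continuous_image[OF c_cont compact_UNIV_prod[OF comp]] by (rule compact_imp_bounded)
  then obtain K where K: "\<And>x y. c x y \<le> K"
    unfolding bounded_iff by (auto simp: abs_le_iff)
  (* The potential and the scaled cost are (Lip / \<epsilon>)-Lipschitz, so on a ball of radius \<epsilon> each of them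
     varies by at most Lip. The other two terms come from the lower bound C * \<epsilon> powr D for the mass of
     the ball, where ln (1 / \<epsilon>) is at least 1 and absorbs the constants. *)
  define A where "A = 2 * Lip - ln C + D"
  have "ln C \<le> 0"
    using C by simp
  then have A: "0 < A"
    using Lip(1) D by (simp add: A_def)
  have "\<forall>\<^sub>F \<epsilon> in at_right (0 :: real). 0 < \<epsilon> \<and> \<epsilon> < min \<delta>\<^sub>0 (exp (- 1))"
    using \<delta>\<^sub>0 by (intro eventually_at_rightI[of 0 "min \<delta>\<^sub>0 (exp (- 1))"]) auto
  then have "\<forall>\<^sub>F \<epsilon> in at_right 0. concentrated_kernel M c \<epsilon> A (entropic_kernel c \<epsilon> M M)"
  proof eventually_elim
    case (elim \<epsilon>)
    then have \<epsilon>: "0 < \<epsilon>" "\<epsilon> \<le> \<delta>\<^sub>0" "\<epsilon> < exp (- 1)"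
      by auto
    have log: "1 \<le> ln (1 / \<epsilon>)"
    proof -
      have "ln \<epsilon> < ln (exp (- 1))"
        using \<epsilon> by (subst ln_less_cancel_iff) auto
      then show ?thesis
        using \<epsilon> by (simp add: ln_div)
    qed
    have cc: "compact_cost M (\<lambda>x y. c x y / \<epsilon>) (K / \<epsilon>) (Lip / \<epsilon>)"
    proof
      show "\<bar>c x y / \<epsilon> - c x' y / \<epsilon>\<bar> \<le> Lip / \<epsilon> * dist x x'" for x x' y
        using divide_right_mono[OF Lip(2)[of x y x'], of \<epsilon>] \<epsilon>(1)
        by (simp add: diff_divide_distrib[symmetric])
    qed (use comp bp c_nonneg K c_commute Lip(1) \<epsilon>(1) in \<open>auto simp: borel_prob_def divide_right_mono\<close>)
    interpret cc: compact_cost M "\<lambda>x y. c x y / \<epsilon>" "K / \<epsilon>" "Lip / \<epsilon>" by (rule cc)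
    obtain g where g: "continuous_on UNIV g" "\<And>x. cc.soft_transform g x = g x"
      and k: "entropic_kernel c \<epsilon> M M = (\<lambda>x y. exp (g x + g y - c x y / \<epsilon>))"
      using entropic_kernel_symmetric_form[OF cc \<epsilon>(1) c_cont] by blast
    have g_le: "2 * g x \<le> A * ln (1 / \<epsilon>)" if "x \<in> spt M" for x
    proof -
      have pos: "0 < C * \<epsilon> powr D"
        using C \<epsilon>(1) by simp
      have ball: "C * \<epsilon> powr D \<le> prob (ball x \<epsilon>)"
        by (rule mass[OF \<epsilon>(1,2) that])
      have "2 * g x \<le> 2 * (Lip / \<epsilon>) * \<epsilon> - ln (prob (ball x \<epsilon>))"
        using pos ball by (intro cc.potential_le_ball_mass g) (auto simp: c_refl)
      also have "\<dots> \<le> 2 * Lip - ln (C * \<epsilon> powr D)"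
        using pos ball \<epsilon>(1) by simp
      also have "\<dots> = (2 * Lip - ln C) * 1 + D * ln (1 / \<epsilon>)"
        using C \<epsilon>(1) by (simp add: ln_mult ln_powr ln_div)
      also have "\<dots> \<le> (2 * Lip - ln C) * ln (1 / \<epsilon>) + D * ln (1 / \<epsilon>)"
        using log \<open>ln C \<le> 0\<close> Lip(1) by (intro add_right_mono mult_left_mono) auto
      finally show ?thesis
        by (simp add: A_def distrib_right)
    qed
    have "continuous_on UNIV (\<lambda>p. c (fst p) (snd p))"
      using c_cont by (simp add: case_prod_unfold)
    then have "continuous_on UNIV (\<lambda>p. exp (g (fst p) + g (snd p) - c (fst p) (snd p) / \<epsilon>))"
      using \<epsilon>(1) continuous_on_compose2[OF g(1) continuous_on_fst[OF continuous_on_id], of UNIV]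
        continuous_on_compose2[OF g(1) continuous_on_snd[OF continuous_on_id], of UNIV]
      by (intro continuous_intros) auto
    then have "continuous_on UNIV (\<lambda>(x, y). entropic_kernel c \<epsilon> M M x y)"
      unfolding k by (simp add: case_prod_unfold)
    moreover have "entropic_kernel c \<epsilon> M M x y = entropic_kernel c \<epsilon> M M y x" for x y
      unfolding k c_commute[of x y] add.commute[of "g x"] ..
    moreover have "(\<integral>y. entropic_kernel c \<epsilon> M M x y \<partial>M) = 1" for x
      unfolding k by (rule cc.self_kernel_integral[OF g])
    moreover have "entropic_kernel c \<epsilon> M M x y \<le> exp (A * ln (1 / \<epsilon>) - c x y / \<epsilon>)"
      if "x \<in> spt M" "y \<in> spt M" for x y
      using g_le[OF that(1)] g_le[OF that(2)] unfolding k by simp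
    ultimately show ?case
      unfolding concentrated_kernel_def by (simp add: k)
  qed
  with A show ?thesis by blast
qed

section \<open>The smoothing error of the transport density\<close>

lemma density_of_RN_deriv:
  assumes "sigma_finite_measure P" "sigma_finite_measure Q"
    and ac: "absolutely_continuous P Q" "sets Q = sets P"
    and t: "t \<in> borel_measurable P" "AE z in P. t z = enn2real (RN_deriv P Q z)"
  shows "Q = density P (\<lambda>z. ennreal (t z))" and "AE z in P. 0 \<le> t z"
proof -
  interpret P: sigma_finite_measure P by fact
  show "AE z in P. 0 \<le> t z"
    using t(2) by eventually_elim simp
  have "AE z in P. RN_deriv P Q z = ennreal (t z)"
    using P.RN_deriv_finite[OF assms(2) ac] t(2)
    by eventually_elim (simp add: less_top)
  then have "density P (RN_deriv P Q) = density P (\<lambda>z. ennreal (t z))"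
    using t(1) by (intro density_cong) auto
  then show "Q = density P (\<lambda>z. ennreal (t z))"
    by (simp add: P.density_RN_deriv[OF ac])
qed

text \<open>Where both costs are at most \<open>B * \<epsilon> * ln (1 / \<epsilon>)\<close>, the modulus of continuity is of the claimed
  order. Where one of them is larger, the choice \<open>B = A + l\<close> makes the corresponding kernel at
  most \<open>\<epsilon> powr l\<close>, while the other kernel is still integrable.\<close>

lemma kernel_product_modulus_le:
  fixes k k' a b A B l \<epsilon> cm :: real
  assumes \<epsilon>: "0 < \<epsilon>" "\<epsilon> \<le> 1" and "0 < l" and B: "B = A + l"
    and k: "0 \<le> k" "k \<le> exp (A * ln (1 / \<epsilon>) - a / \<epsilon>)"
    and k': "0 \<le> k'" "k' \<le> exp (A * ln (1 / \<epsilon>) - b / \<epsilon>)"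
    and a: "0 \<le> a" "a \<le> cm" and b: "0 \<le> b" "b \<le> cm"
  shows "k * k' * (a + b) powr l
    \<le> (2 * B * (\<epsilon> * ln (1 / \<epsilon>))) powr l * (k * k') + (2 * cm) powr l * \<epsilon> powr l * (k + k')"
proof -
  define s where "s = \<epsilon> * ln (1 / \<epsilon>)"
  have "0 \<le> s"
    unfolding s_def using \<epsilon> by (intro mult_nonneg_nonneg) auto
  have small: "q \<le> \<epsilon> powr l" if "B * s < d" "q \<le> exp (A * ln (1 / \<epsilon>) - d / \<epsilon>)" for q d
  proof -
    have "B * ln (1 / \<epsilon>) < d / \<epsilon>"
      using that(1) \<epsilon>(1) by (simp add: s_def field_simps)
    then have "A * ln (1 / \<epsilon>) - d / \<epsilon> \<le> l * ln \<epsilon>"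
      using \<epsilon>(1) by (simp add: B ln_div algebra_simps)
    then have "exp (A * ln (1 / \<epsilon>) - d / \<epsilon>) \<le> exp (l * ln \<epsilon>)"
      by simp
    also have "\<dots> = \<epsilon> powr l"
      using \<epsilon>(1) by (simp add: powr_def)
    finally show ?thesis
      using that(2) by linarith
  qed
  have cm: "(a + b) powr l \<le> (2 * cm) powr l"
    using a b \<open>0 < l\<close> by (intro powr_mono2) auto
  consider "a \<le> B * s \<and> b \<le> B * s" | "B * s < a" | "B * s < b"
    by linarith
  then show ?thesis
  proof cases
    case 1
    then have "(a + b) powr l \<le> (2 * B * s) powr l"
      using a b \<open>0 < l\<close> by (intro powr_mono2) auto
    then have "k * k' * (a + b) powr l \<le> k * k' * (2 * B * s) powr l"
      using k(1) k'(1) by (intro mult_left_mono) auto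
    moreover have "0 \<le> (2 * cm) powr l * \<epsilon> powr l * (k + k')"
      using k(1) k'(1) by simp
    ultimately show ?thesis
      by (simp add: s_def mult_ac)
  next
    case 2
    have "k * k' * (a + b) powr l \<le> \<epsilon> powr l * k' * (2 * cm) powr l"
      using small[OF 2 k(2)] cm k(1) k'(1) by (intro mult_mono) auto
    moreover have "0 \<le> (2 * B * s) powr l * (k * k')" "0 \<le> (2 * cm) powr l * \<epsilon> powr l * k"
      using k(1) k'(1) by simp_all
    ultimately show ?thesis
      unfolding s_def by (simp add: algebra_simps)
  next
    case 3
    have "k * k' * (a + b) powr l \<le> k * \<epsilon> powr l * (2 * cm) powr l"
      using small[OF 3 k'(2)] cm k(1) k'(1) by (intro mult_mono) auto
    moreover have "0 \<le> (2 * B * s) powr l * (k * k')" "0 \<le> (2 * cm) powr l * \<epsilon> powr l * k'"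
      using k(1) k'(1) by simp_all
    ultimately show ?thesis
      unfolding s_def by (simp add: algebra_simps)
  qed
qed

text \<open>Both kernels are probability densities, so the left-hand side is an average of
  \<open>t x' y' - t x y\<close>. The base points have to lie in the supports for the kernel bounds to apply.\<close>

lemma smoothing_error:
  fixes M N :: "'a::{metric_space, second_countable_topology} measure"
    and k k' c t :: "'a \<Rightarrow> 'a \<Rightarrow> real"
  assumes comp: "compact (UNIV :: 'a set)" and M: "borel_prob M" and N: "borel_prob N"
    and t_cont: "continuous_on UNIV (\<lambda>(x, y). t x y)"
    and t_mod: "\<And>x x' y y'. \<bar>t x' y' - t x y\<bar> \<le> L * (c x x' + c y y') powr l"
    and c_nonneg: "\<And>x y. 0 \<le> c x y" and cm: "\<And>x y. c x y \<le> cm" and L: "0 < L" and l: "0 < l"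
    and \<epsilon>: "0 < \<epsilon>" "\<epsilon> \<le> exp (- 1)" and A: "0 < A"
    and k: "concentrated_kernel M c \<epsilon> A k" and k': "concentrated_kernel N c \<epsilon> A k'"
    and x: "x \<in> spt M" and y: "y \<in> spt N"
  shows "\<bar>(\<integral>(x', y'). t x' y' * (k x x' * k' y y') \<partial>(M \<Otimes>\<^sub>M N)) - t x y\<bar>
    \<le> L * ((2 * (A + l)) powr l + 2 * (2 * cm) powr l) * (\<epsilon> * ln (1 / \<epsilon>)) powr l"
proof -
  interpret M: prob_space M using M by (simp add: borel_prob_def)
  interpret N: prob_space N using N by (simp add: borel_prob_def)
  interpret P: pair_prob_space M N ..
  let ?P = "M \<Otimes>\<^sub>M N"
  have sets: "sets M = sets borel" "sets N = sets borel"
    using M N by (simp_all add: borel_prob_def)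
  note k = concentrated_kernelD(2,3,5)[OF k, of x] concentrated_kernelD(6)[OF k x]
  note k' = concentrated_kernelD(2,3,5)[OF k', of y] concentrated_kernelD(6)[OF k' y]
  define s where "s = \<epsilon> * ln (1 / \<epsilon>)"
  have "\<epsilon> \<le> s"
  proof -
    have "ln \<epsilon> \<le> ln (exp (- 1))"
      using \<epsilon> by (subst ln_le_cancel_iff) auto
    then have "1 \<le> ln (1 / \<epsilon>)"
      using \<epsilon>(1) by (simp add: ln_div)
    then show ?thesis
      unfolding s_def using \<epsilon>(1) mult_left_mono[of 1 "ln (1 / \<epsilon>)" \<epsilon>] by simp
  qed
  have "\<epsilon> \<le> 1"
    using \<epsilon>(2) by (rule order_trans) simp
  have k_int: "integrable M (k x)" "integrable N (k' y)"
    by (intro integrable_continuous_compact M.finite_measure_axioms N.finite_measure_axioms sets comp k k')+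
  have one_int: "integrable M (\<lambda>_. 1 :: real)" "integrable N (\<lambda>_. 1 :: real)"
    by simp_all
  define kk where "kk = (\<lambda>p. k x (fst p) * k' y (snd p))"
  note prod_facts = M.prob_space_axioms N.prob_space_axioms
  have kk_int: "integrable ?P kk" and kk_eq: "(\<integral>p. kk p \<partial>?P) = 1"
    using pair_integrable_mult[OF prod_facts k_int] by (simp_all add: kk_def case_prod_unfold k k')
  have kx_int: "integrable ?P (\<lambda>p. k x (fst p))" and kx_eq: "(\<integral>p. k x (fst p) \<partial>?P) = 1"
    using pair_integrable_mult[OF prod_facts k_int(1) one_int(2)]
    by (simp_all add: case_prod_unfold k N.prob_space)
  have ky_int: "integrable ?P (\<lambda>p. k' y (snd p))" and ky_eq: "(\<integral>p. k' y (snd p) \<partial>?P) = 1"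
    using pair_integrable_mult[OF prod_facts one_int(1) k_int(2)]
    by (simp_all add: case_prod_unfold k' M.prob_space)
  define tt where "tt = (\<lambda>p. t (fst p) (snd p))"
  have "continuous_on UNIV tt"
    using t_cont by (simp add: tt_def case_prod_unfold)
  moreover have "continuous_on UNIV kk"
    unfolding kk_def
    using continuous_on_compose2[OF k(1) continuous_on_fst[OF continuous_on_id], of UNIV]
      continuous_on_compose2[OF k'(1) continuous_on_snd[OF continuous_on_id], of UNIV]
    by (intro continuous_on_mult) simp_all
  ultimately have tkk_int: "integrable ?P (\<lambda>p. tt p * kk p)"
    by (intro integrable_continuous_compact P.finite_measure_axioms sets_pair_borel sets
        compact_UNIV_prod comp continuous_on_mult)
  have diff_int: "integrable ?P (\<lambda>p. (tt p - t x y) * kk p)"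
    using tkk_int kk_int by (simp add: left_diff_distrib)
  define R where "R = (\<lambda>p. (2 * (A + l) * s) powr l * kk p
      + (2 * cm) powr l * \<epsilon> powr l * (k x (fst p) + k' y (snd p)))"
  have R_int: "integrable ?P (\<lambda>p. L * R p)"
    unfolding R_def using kk_int kx_int ky_int by simp
  have "AE p in ?P. fst p \<in> spt M \<and> snd p \<in> spt N"
  proof (rule P.AE_pair_measure)
    have "{p \<in> space ?P. fst p \<in> spt M \<and> snd p \<in> spt N} = spt M \<times> spt N"
      using sets_eq_imp_space_eq[OF sets(1)] sets_eq_imp_space_eq[OF sets(2)]
      by (auto simp: space_pair_measure)
    then show "{p \<in> space ?P. fst p \<in> spt M \<and> snd p \<in> spt N} \<in> sets ?P"
      unfolding sets_pair_borel[OF sets] by (simp add: closed_Times closed_spt)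
    show "AE x in M. AE y in N. fst (x, y) \<in> spt M \<and> snd (x, y) \<in> spt N"
      using AE_in_spt[OF sets(1)] AE_in_spt[OF sets(2)] by auto
  qed
  then have pointwise: "AE p in ?P. \<bar>(tt p - t x y) * kk p\<bar> \<le> L * R p"
  proof eventually_elim
    case (elim p)
    have "\<bar>(tt p - t x y) * kk p\<bar> = \<bar>tt p - t x y\<bar> * kk p"
      using k(2) k'(2) by (simp add: abs_mult kk_def)
    also have "\<dots> \<le> L * (c x (fst p) + c y (snd p)) powr l * kk p"
      unfolding tt_def using k(2) k'(2) by (intro mult_right_mono t_mod) (simp add: kk_def)
    also have "\<dots> = L * (k x (fst p) * k' y (snd p) * (c x (fst p) + c y (snd p)) powr l)"
      by (simp add: kk_def)
    also have "\<dots> \<le> L * R p"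
      unfolding R_def kk_def s_def using elim L \<epsilon>(1) \<open>\<epsilon> \<le> 1\<close> A l k k'
      by (intro mult_left_mono kernel_product_modulus_le[where A = A]) (auto simp: c_nonneg cm)
    finally show ?case .
  qed
  have "(\<integral>p. tt p * kk p \<partial>?P) - t x y = (\<integral>p. (tt p - t x y) * kk p \<partial>?P)"
    using tkk_int kk_int kk_eq by (simp add: left_diff_distrib)
  also have "\<bar>\<dots>\<bar> \<le> (\<integral>p. \<bar>(tt p - t x y) * kk p\<bar> \<partial>?P)"
    by (rule integral_abs_bound)
  also have "\<dots> \<le> (\<integral>p. L * R p \<partial>?P)"
    by (intro integral_mono_AE pointwise R_int integrable_abs diff_int)
  also have "\<dots> = L * ((2 * (A + l) * s) powr l + (2 * cm) powr l * \<epsilon> powr l * 2)"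
    unfolding R_def using kk_int kx_int ky_int by (simp add: kk_eq kx_eq ky_eq)
  also have "\<dots> \<le> L * ((2 * (A + l)) powr l * s powr l + (2 * cm) powr l * s powr l * 2)"
  proof -
    have "\<epsilon> powr l \<le> s powr l"
      using \<open>\<epsilon> \<le> s\<close> \<epsilon>(1) l by (intro powr_mono2) auto
    moreover have "(2 * (A + l) * s) powr l = (2 * (A + l)) powr l * s powr l"
      by (simp add: powr_mult)
    ultimately show ?thesis
      using L by (intro mult_left_mono add_mono mult_right_mono) auto
  qed
  finally show ?thesis
    unfolding tt_def kk_def s_def by (simp add: case_prod_unfold algebra_simps)
qed

text \<open>Since \<open>c\<close> is continuous and vanishes on the diagonal, the modulus tends to zero at every
  point.\<close>

lemma modulus_continuous:
  fixes c t :: "'a::metric_space \<Rightarrow> 'a \<Rightarrow> real"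
  assumes c: "continuous_on UNIV (\<lambda>(x, y). c x y)" "\<And>x. c x x = 0" "\<And>x y. 0 \<le> c x y"
    and l: "0 < l"
    and t_mod: "\<And>x x' y y'. \<bar>t x' y' - t x y\<bar> \<le> L * (c x x' + c y y') powr l"
  shows "continuous_on UNIV (\<lambda>(x, y). t x y)"
  unfolding continuous_on_def
proof
  fix p :: "'a \<times> 'a"
  obtain x y where p: "p = (x, y)"
    by fastforce
  have c1: "continuous_on UNIV (\<lambda>q :: 'a \<times> 'a. c x (fst q))"
    using continuous_on_compose2[OF c(1), of UNIV "\<lambda>q :: 'a \<times> 'a. (x, fst q)"]
    by (simp add: continuous_intros)
  have c2: "continuous_on UNIV (\<lambda>q :: 'a \<times> 'a. c y (snd q))"
    using continuous_on_compose2[OF c(1), of UNIV "\<lambda>q :: 'a \<times> 'a. (y, snd q)"]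
    by (simp add: continuous_intros)
  have "((\<lambda>q. c x (fst q) + c y (snd q)) \<longlongrightarrow> c x (fst p) + c y (snd p)) (at p)"
    using continuous_on_add[OF c1 c2] unfolding continuous_on_def by blast
  then have "((\<lambda>q. c x (fst q) + c y (snd q)) \<longlongrightarrow> 0) (at p)"
    by (simp add: p c(2))
  then have "((\<lambda>q. L * (c x (fst q) + c y (snd q)) powr l) \<longlongrightarrow> L * 0 powr l) (at p)"
    using l c(3) by (intro tendsto_mult tendsto_const tendsto_powr') auto
  then have lim: "((\<lambda>q. L * (c x (fst q) + c y (snd q)) powr l) \<longlongrightarrow> 0) (at p)"
    by simp
  have "((\<lambda>q. t (fst q) (snd q) - t x y) \<longlongrightarrow> 0) (at p)"
  proof (rule Lim_null_comparison[OF always_eventually lim], rule allI)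
    show "norm (t (fst q) (snd q) - t x y) \<le> L * (c x (fst q) + c y (snd q)) powr l" for q
      unfolding real_norm_def by (rule t_mod)
  qed
  then show "((\<lambda>(x, y). t x y) \<longlongrightarrow> (case p of (x, y) \<Rightarrow> t x y)) (at p within UNIV)"
    by (simp add: p case_prod_unfold LIM_zero_iff)
qed

section \<open>The transfer operator as an integral operator\<close>

text \<open>By Fubini the integral operator with kernel \<open>t\<close> satisfies the defining property of the transfer
  operator, and testing with the difference shows that this property determines the value almost
  everywhere.\<close>

lemma transfer_op_AE_eq:
  fixes t :: "'a \<Rightarrow> 'a \<Rightarrow> real"
  assumes "prob_space \<mu>" "prob_space \<nu>"
    and t: "(\<lambda>(x, y). t x y) \<in> borel_measurable (\<mu> \<Otimes>\<^sub>M \<nu>)"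
    and t_bound: "\<And>x y. \<bar>t x y\<bar> \<le> b" and t_nonneg: "AE (x, y) in \<mu> \<Otimes>\<^sub>M \<nu>. 0 \<le> t x y"
    and \<pi>: "\<pi> = density (\<mu> \<Otimes>\<^sub>M \<nu>) (\<lambda>(x, y). ennreal (t x y))"
    and u: "u \<in> L2 \<mu>"
  shows "transfer_op \<mu> \<nu> \<pi> u \<in> L2 \<nu>"
    and "AE y in \<nu>. transfer_op \<mu> \<nu> \<pi> u y = (\<integral>x. u x * t x y \<partial>\<mu>)"
proof -
  interpret \<mu>: prob_space \<mu> by fact
  interpret \<nu>: prob_space \<nu> by fact
  interpret P: pair_prob_space \<mu> \<nu> ..
  let ?P = "\<mu> \<Otimes>\<^sub>M \<nu>"
  define w where "w = (\<lambda>y. \<integral>x. u x * t x y \<partial>\<mu>)"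
  have u_int: "integrable \<mu> u"
    by (rule \<mu>.L2_integrable[OF u])
  have u_meas[measurable]: "u \<in> borel_measurable \<mu>"
    by (rule L2_measurable[OF u])
  note t[measurable]
  have w_meas: "w \<in> borel_measurable \<nu>"
    unfolding w_def by measurable
  have w_bound: "\<bar>w y\<bar> \<le> (\<integral>x. \<bar>u x\<bar> * b \<partial>\<mu>)" if "y \<in> space \<nu>" for y
  proof -
    have [measurable]: "(\<lambda>x. t x y) \<in> borel_measurable \<mu>"
      using measurable_compose[OF measurable_Pair2'[OF that] t] by simp
    have "integrable \<mu> (\<lambda>x. \<bar>u x\<bar> * b)"
      using u_int by auto
    moreover have "integrable \<mu> (\<lambda>x. u x * t x y)"
    proof (rule Bochner_Integration.integrable_bound[OF \<open>integrable \<mu> (\<lambda>x. \<bar>u x\<bar> * b)\<close>])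
      show "AE x in \<mu>. norm (u x * t x y) \<le> norm (\<bar>u x\<bar> * b)"
        using order_trans[OF t_bound abs_ge_self] by (auto simp: abs_mult intro!: mult_left_mono)
    qed simp
    ultimately have "(\<integral>x. \<bar>u x * t x y\<bar> \<partial>\<mu>) \<le> (\<integral>x. \<bar>u x\<bar> * b \<partial>\<mu>)"
      by (intro integral_mono integrable_abs) (auto simp: abs_mult intro!: mult_left_mono t_bound)
    then show ?thesis
      unfolding w_def by (rule order_trans[OF integral_abs_bound])
  qed
  have w: "w \<in> L2 \<nu>"
    by (rule \<nu>.bounded_in_L2(1)[OF w_meas]) (use w_bound in auto)
  have w_char: "(\<integral>y. w y * v y \<partial>\<nu>) = (\<integral>(x, y). u x * v y \<partial>\<pi>)" if v: "v \<in> L2 \<nu>" for v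
  proof -
    have [measurable]: "v \<in> borel_measurable \<nu>"
      by (rule L2_measurable[OF v])
    have uv: "integrable ?P (\<lambda>(x, y). b * (u x * v y))"
      using pair_integrable_mult(1)[OF assms(1,2) u_int \<nu>.L2_integrable[OF v]]
      by (simp add: case_prod_unfold)
    have tuv: "integrable ?P (\<lambda>(x, y). t x y * (u x * v y))"
    proof (rule Bochner_Integration.integrable_bound[OF uv])
      show "(\<lambda>(x, y). t x y * (u x * v y)) \<in> borel_measurable ?P"
        by measurable
      have "norm (t x y * (u x * v y)) \<le> norm (b * (u x * v y))" for x y
        using t_bound[of x y] by (auto simp: abs_mult intro!: mult_right_mono)
      then show "AE p in ?P. norm (case p of (x, y) \<Rightarrow> t x y * (u x * v y))
          \<le> norm (case p of (x, y) \<Rightarrow> b * (u x * v y))"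
        by auto
    qed
    have "(\<integral>(x, y). u x * v y \<partial>\<pi>) = (\<integral>p. (case p of (x, y) \<Rightarrow> t x y) *\<^sub>R (case p of (x, y) \<Rightarrow> u x * v y) \<partial>?P)"
      unfolding \<pi> using t_nonneg
      by (subst integral_density[symmetric]) (auto simp: case_prod_unfold)
    also have "\<dots> = (\<integral>(x, y). t x y * (u x * v y) \<partial>?P)"
      by (simp add: case_prod_unfold)
    also have "\<dots> = (\<integral>y. (\<integral>x. t x y * (u x * v y) \<partial>\<mu>) \<partial>\<nu>)"
      by (rule P.integral_snd[OF tuv, symmetric])
    also have "\<dots> = (\<integral>y. (\<integral>x. u x * t x y * v y \<partial>\<mu>) \<partial>\<nu>)"
      by (simp add: mult_ac)
    finally show ?thesis
      by (simp add: w_def)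
  qed
  have "transfer_op \<mu> \<nu> \<pi> u \<in> L2 \<nu> \<and>
      (\<forall>v\<in>L2 \<nu>. (\<integral>y. transfer_op \<mu> \<nu> \<pi> u y * v y \<partial>\<nu>) = (\<integral>(x, y). u x * v y \<partial>\<pi>))"
    unfolding transfer_op_def by (rule someI[of _ w]) (use w w_char in blast)
  then have T: "transfer_op \<mu> \<nu> \<pi> u \<in> L2 \<nu>"
    and T_char: "\<And>v. v \<in> L2 \<nu> \<Longrightarrow> L2_inner \<nu> (transfer_op \<mu> \<nu> \<pi> u) v = L2_inner \<nu> w v"
    unfolding L2_inner_def using w_char by auto
  show "transfer_op \<mu> \<nu> \<pi> u \<in> L2 \<nu>"
    by (rule T)
  have d: "(\<lambda>y. transfer_op \<mu> \<nu> \<pi> u y - w y) \<in> L2 \<nu>"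
    by (rule L2_diff[OF T w])
  have "AE y in \<nu>. transfer_op \<mu> \<nu> \<pi> u y - w y = 0"
    using L2_inner_diff_left[OF T w d] T_char[OF d] by (intro L2_inner_self_eq_0 d) simp
  then show "AE y in \<nu>. transfer_op \<mu> \<nu> \<pi> u y = (\<integral>x. u x * t x y \<partial>\<mu>)"
    by eventually_elim (simp add: w_def)
qed

lemma entropic_density_measurable:
  fixes \<mu> \<nu> :: "'a::{metric_space, second_countable_topology} measure"
  assumes "sets \<mu> = sets borel" "sets \<nu> = sets borel" "borel_prob \<pi>"
    and k: "continuous_on UNIV (\<lambda>(x, y). entropic_kernel c \<epsilon> \<mu> \<mu> x y)"
      "continuous_on UNIV (\<lambda>(x, y). entropic_kernel c \<epsilon> \<nu> \<nu> x y)"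
  shows "(\<lambda>(x, y). entropic_density c \<mu> \<nu> \<pi> \<epsilon> x y) \<in> borel_measurable (\<mu> \<Otimes>\<^sub>M \<nu>)"
proof -
  interpret \<pi>: prob_space \<pi> using assms(3) by (simp add: borel_prob_def)
  define F :: "('a \<times> 'a) \<times> ('a \<times> 'a) \<Rightarrow> real" where
    "F = (\<lambda>z. entropic_kernel c \<epsilon> \<mu> \<mu> (fst (fst z)) (fst (snd z))
      * entropic_kernel c \<epsilon> \<nu> \<nu> (snd (snd z)) (snd (fst z)))"
  have "continuous_on UNIV F"
    unfolding F_def
    using continuous_on_compose2[OF k(1), of UNIV "\<lambda>z :: ('a \<times> 'a) \<times> ('a \<times> 'a). (fst (fst z), fst (snd z))"]
      continuous_on_compose2[OF k(2), of UNIV "\<lambda>z :: ('a \<times> 'a) \<times> ('a \<times> 'a). (snd (snd z), snd (fst z))"]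
    by (intro continuous_on_mult) (simp_all add: continuous_intros)
  then have "F \<in> borel_measurable borel"
    by (rule borel_measurable_continuous_onI)
  moreover have "sets ((\<mu> \<Otimes>\<^sub>M \<nu>) \<Otimes>\<^sub>M \<pi>) = sets borel"
    using assms(3) by (intro sets_pair_borel assms(1,2)) (simp add: borel_prob_def)
  ultimately have "F \<in> borel_measurable ((\<mu> \<Otimes>\<^sub>M \<nu>) \<Otimes>\<^sub>M \<pi>)"
    using measurable_cong_sets by blast
  then have "(\<lambda>p. \<integral>q. F (p, q) \<partial>\<pi>) \<in> borel_measurable (\<mu> \<Otimes>\<^sub>M \<nu>)"
    by (intro \<pi>.borel_measurable_lebesgue_integral) (simp add: case_prod_unfold)
  then show ?thesis
    by (simp add: F_def entropic_density_def case_prod_unfold)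
qed

text \<open>The difference of the two operators is an integral operator whose kernel is the difference of the
  densities. The bound on the supports is a bound almost everywhere, as their complements are null
  sets.\<close>

lemma operator_difference_hilbert_schmidt:
  fixes \<mu> \<nu> :: "'a::{metric_space, second_countable_topology} measure" and t \<tau> :: "'a \<Rightarrow> 'a \<Rightarrow> real"
  assumes \<mu>: "borel_prob \<mu>" and \<nu>: "borel_prob \<nu>"
    and t: "(\<lambda>(x, y). t x y) \<in> borel_measurable (\<mu> \<Otimes>\<^sub>M \<nu>)"
    and \<tau>: "(\<lambda>(x, y). entropic_density c \<mu> \<nu> \<pi> \<epsilon> x y) \<in> borel_measurable (\<mu> \<Otimes>\<^sub>M \<nu>)"
    and t_bound: "\<And>x y. \<bar>t x y\<bar> \<le> b" and t_nonneg: "AE (x, y) in \<mu> \<Otimes>\<^sub>M \<nu>. 0 \<le> t x y"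
    and \<pi>: "\<pi> = density (\<mu> \<Otimes>\<^sub>M \<nu>) (\<lambda>(x, y). ennreal (t x y))"
    and close: "\<And>x y. x \<in> spt \<mu> \<Longrightarrow> y \<in> spt \<nu> \<Longrightarrow> \<bar>entropic_density c \<mu> \<nu> \<pi> \<epsilon> x y - t x y\<bar> \<le> r"
    and "0 \<le> r"
  shows "hilbert_schmidt \<mu> \<nu>
      (\<lambda>u y. entropic_transfer_op c \<mu> \<nu> \<pi> \<epsilon> u y - transfer_op \<mu> \<nu> \<pi> u y)"
    and "hs_norm \<mu> \<nu>
      (\<lambda>u y. entropic_transfer_op c \<mu> \<nu> \<pi> \<epsilon> u y - transfer_op \<mu> \<nu> \<pi> u y) \<le> r"
proof -
  interpret \<mu>: prob_space \<mu> using \<mu> by (simp add: borel_prob_def)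
  interpret \<nu>: prob_space \<nu> using \<nu> by (simp add: borel_prob_def)
  have sets: "sets \<mu> = sets borel" "sets \<nu> = sets borel"
    using \<mu> \<nu> by (simp_all add: borel_prob_def)
  note prob = \<mu>.prob_space_axioms \<nu>.prob_space_axioms
  define h where "h = (\<lambda>x y. entropic_density c \<mu> \<nu> \<pi> \<epsilon> x y - t x y)"
  have h: "(\<lambda>(x, y). h x y) \<in> borel_measurable (\<mu> \<Otimes>\<^sub>M \<nu>)"
    using borel_measurable_diff[OF \<tau> t] by (simp add: h_def case_prod_unfold)
  have h_bound: "AE y in \<nu>. AE x in \<mu>. \<bar>h x y\<bar> \<le> r"
    using AE_in_spt[OF sets(2)]
  proof eventually_elim
    case (elim y)
    show ?case
      using AE_in_spt[OF sets(1)] by eventually_elim (simp add: h_def close elim)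
  qed
  define A where "A = (\<lambda>u y. entropic_transfer_op c \<mu> \<nu> \<pi> \<epsilon> u y - transfer_op \<mu> \<nu> \<pi> u y)"
  have meas: "A u \<in> borel_measurable \<nu>" if u: "u \<in> L2 \<mu>" for u
  proof -
    note L2_measurable[OF u, measurable] \<tau>[measurable]
      L2_measurable[OF transfer_op_AE_eq(1)[OF prob t t_bound t_nonneg \<pi> u], measurable]
    show ?thesis
      unfolding A_def entropic_transfer_op_def by measurable
  qed
  have eq: "AE y in \<nu>. A u y = (\<integral>x. u x * h x y \<partial>\<mu>)" if u: "u \<in> L2 \<mu>" for u
    using transfer_op_AE_eq(2)[OF prob t t_bound t_nonneg \<pi> u] h_bound AE_space
  proof eventually_elim
    case (elim y)
    have "(\<lambda>x. h x y) \<in> borel_measurable \<mu>" "(\<lambda>x. t x y) \<in> borel_measurable \<mu>"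
      using measurable_compose[OF measurable_Pair2'[OF elim(3)] h]
        measurable_compose[OF measurable_Pair2'[OF elim(3)] t] by simp_all
    then have hL: "(\<lambda>x. h x y) \<in> L2 \<mu>" and tL: "(\<lambda>x. t x y) \<in> L2 \<mu>"
      using \<mu>.bounded_in_L2(1) elim(2) t_bound by blast+
    have "(\<integral>x. u x * entropic_density c \<mu> \<nu> \<pi> \<epsilon> x y \<partial>\<mu>) = (\<integral>x. u x * h x y + u x * t x y \<partial>\<mu>)"
      by (simp add: h_def right_diff_distrib)
    also have "\<dots> = (\<integral>x. u x * h x y \<partial>\<mu>) + (\<integral>x. u x * t x y \<partial>\<mu>)"
      by (intro Bochner_Integration.integral_add L2_mult_integrable u hL tL)
    finally show ?case
      by (simp add: A_def entropic_transfer_op_def elim(1))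
  qed
  show "hilbert_schmidt \<mu> \<nu> (\<lambda>u y. entropic_transfer_op c \<mu> \<nu> \<pi> \<epsilon> u y - transfer_op \<mu> \<nu> \<pi> u y)"
    "hs_norm \<mu> \<nu> (\<lambda>u y. entropic_transfer_op c \<mu> \<nu> \<pi> \<epsilon> u y - transfer_op \<mu> \<nu> \<pi> u y) \<le> r"
    using hilbert_schmidt_bounded_kernel[OF prob h h_bound \<open>0 \<le> r\<close>, of A] meas eq
    unfolding A_def by blast+
qed

section \<open>The convergence rate\<close>

theorem theorem2p25:
  fixes \<mu> \<nu> :: "'a::{metric_space, second_countable_topology} measure"
    and \<pi> :: "('a \<times> 'a) measure"
    and c t :: "'a \<Rightarrow> 'a \<Rightarrow> real"
    and l :: real
  assumes "compact (UNIV :: 'a set)"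
    and "borel_prob \<mu>" and "borel_prob \<nu>" and "coupling \<mu> \<nu> \<pi>"
    and "ball_mass \<mu>" and "ball_mass \<nu>"
    and "lipschitz_cost c"
    and "absolutely_continuous (\<mu> \<Otimes>\<^sub>M \<nu>) \<pi>"
    and "AE (x, y) in \<mu> \<Otimes>\<^sub>M \<nu>. t x y = enn2real (RN_deriv (\<mu> \<Otimes>\<^sub>M \<nu>) \<pi> (x, y))"
    and "l > 0"
    and "\<exists>L>0. \<forall>x x' y y'. \<bar>t x' y' - t x y\<bar> \<le> L * (c x x' + c y y') powr l"
  shows "\<exists>M>0. \<forall>\<^sub>F \<epsilon> in at_right 0.
           (\<forall>x\<in>spt \<mu>. \<forall>y\<in>spt \<nu>.
              \<bar>entropic_density c \<mu> \<nu> \<pi> \<epsilon> x y - t x y\<bar> \<le> M * (\<epsilon> * ln (1 / \<epsilon>)) powr l) \<and>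
           hilbert_schmidt \<mu> \<nu>
             (\<lambda>u y. entropic_transfer_op c \<mu> \<nu> \<pi> \<epsilon> u y - transfer_op \<mu> \<nu> \<pi> u y) \<and>
           hs_norm \<mu> \<nu>
             (\<lambda>u y. entropic_transfer_op c \<mu> \<nu> \<pi> \<epsilon> u y - transfer_op \<mu> \<nu> \<pi> u y)
             \<le> M * (\<epsilon> * ln (1 / \<epsilon>)) powr l"
proof -
  note comp = assms(1)
  interpret \<mu>: prob_space \<mu> using assms(2) by (simp add: borel_prob_def)
  interpret \<nu>: prob_space \<nu> using assms(3) by (simp add: borel_prob_def)
  interpret P: pair_prob_space \<mu> \<nu> ..
  have \<pi>_bp: "borel_prob \<pi>"
    using assms(4) by (simp add: coupling_def)
  interpret \<pi>: prob_space \<pi> using \<pi>_bp by (simp add: borel_prob_def)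
  have sets: "sets \<mu> = sets borel" "sets \<nu> = sets borel"
    using assms(2,3) by (simp_all add: borel_prob_def)
  have sets_P: "sets (\<mu> \<Otimes>\<^sub>M \<nu>) = sets borel"
    by (rule sets_pair_borel[OF sets])
  have sets_\<pi>: "sets \<pi> = sets (\<mu> \<Otimes>\<^sub>M \<nu>)"
    using \<pi>_bp sets_P by (simp add: borel_prob_def)
  have c_cont: "continuous_on UNIV (\<lambda>(x, y). c x y)" and c_nonneg: "\<And>x y. 0 \<le> c x y"
    and c_refl: "\<And>x. c x x = 0"
    using assms(7) unfolding lipschitz_cost_def by blast+
  obtain L where L: "0 < L"
    and t_mod: "\<And>x x' y y'. \<bar>t x' y' - t x y\<bar> \<le> L * (c x x' + c y y') powr l"
    using assms(11) by blast
  have t_cont: "continuous_on UNIV (\<lambda>(x, y). t x y)"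
    by (rule modulus_continuous[OF c_cont c_refl c_nonneg \<open>l > 0\<close> t_mod])
  have bounded: "\<exists>B. \<forall>x y. \<bar>f x y\<bar> \<le> B" if "continuous_on UNIV (\<lambda>(x, y). f x y)"
    for f :: "'a \<Rightarrow> 'a \<Rightarrow> real"
  proof -
    have "bounded (range (\<lambda>(x, y). f x y))"
      using compact_continuous_image[OF that compact_UNIV_prod[OF comp]] by (rule compact_imp_bounded)
    then show ?thesis
      unfolding bounded_iff by auto
  qed
  obtain b where t_bound: "\<And>x y. \<bar>t x y\<bar> \<le> b"
    using bounded[OF t_cont] by blast
  obtain cm where "\<And>x y. \<bar>c x y\<bar> \<le> cm"
    using bounded[OF c_cont] by blast
  then have cm: "c x y \<le> cm" for x y
    using abs_le_D1 by blast
  have t_meas: "(\<lambda>(x, y). t x y) \<in> borel_measurable (\<mu> \<Otimes>\<^sub>M \<nu>)"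
    unfolding measurable_cong_sets[OF sets_P refl] by (rule borel_measurable_continuous_onI[OF t_cont])
  have t_AE: "AE p in \<mu> \<Otimes>\<^sub>M \<nu>. (case p of (x, y) \<Rightarrow> t x y) = enn2real (RN_deriv (\<mu> \<Otimes>\<^sub>M \<nu>) \<pi> p)"
    using assms(9) by (simp add: case_prod_unfold)
  note dens = density_of_RN_deriv[OF P.sigma_finite_measure_axioms \<pi>.sigma_finite_measure_axioms
      assms(8) sets_\<pi> t_meas t_AE]
  have \<pi>_eq: "\<pi> = density (\<mu> \<Otimes>\<^sub>M \<nu>) (\<lambda>(x, y). ennreal (t x y))"
    and t_nonneg: "AE (x, y) in \<mu> \<Otimes>\<^sub>M \<nu>. 0 \<le> t x y"
    using dens by (simp_all add: case_prod_unfold)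
  obtain A1 where A1: "0 < A1"
    and ev1: "\<forall>\<^sub>F \<epsilon> in at_right 0. concentrated_kernel \<mu> c \<epsilon> A1 (entropic_kernel c \<epsilon> \<mu> \<mu>)"
    using entropic_kernel_concentration[OF comp assms(2,5,7)] by blast
  obtain A2 where A2: "0 < A2"
    and ev2: "\<forall>\<^sub>F \<epsilon> in at_right 0. concentrated_kernel \<nu> c \<epsilon> A2 (entropic_kernel c \<epsilon> \<nu> \<nu>)"
    using entropic_kernel_concentration[OF comp assms(3,6,7)] by blast
  define A where "A = max A1 A2"
  have A: "0 < A" "A1 \<le> A" "A2 \<le> A"
    using A1 A2 by (auto simp: A_def)
  define M where "M = L * ((2 * (A + l)) powr l + 2 * (2 * cm) powr l)"
  have "0 < (2 * (A + l)) powr l"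
    using A(1) \<open>l > 0\<close> by simp
  then have M: "0 < M"
    unfolding M_def using L by (intro mult_pos_pos add_pos_nonneg) auto
  have ev0: "\<forall>\<^sub>F \<epsilon> in at_right (0 :: real). 0 < \<epsilon> \<and> \<epsilon> < exp (- 1)"
    by (intro eventually_at_rightI[of 0 "exp (- 1)"]) auto
  show ?thesis
  proof (intro exI conjI)
    show "0 < M" by (rule M)
    show "\<forall>\<^sub>F \<epsilon> in at_right 0.
           (\<forall>x\<in>spt \<mu>. \<forall>y\<in>spt \<nu>.
              \<bar>entropic_density c \<mu> \<nu> \<pi> \<epsilon> x y - t x y\<bar> \<le> M * (\<epsilon> * ln (1 / \<epsilon>)) powr l) \<and>
           hilbert_schmidt \<mu> \<nu>
             (\<lambda>u y. entropic_transfer_op c \<mu> \<nu> \<pi> \<epsilon> u y - transfer_op \<mu> \<nu> \<pi> u y) \<and>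
           hs_norm \<mu> \<nu>
             (\<lambda>u y. entropic_transfer_op c \<mu> \<nu> \<pi> \<epsilon> u y - transfer_op \<mu> \<nu> \<pi> u y)
             \<le> M * (\<epsilon> * ln (1 / \<epsilon>)) powr l"
      using ev0 ev1 ev2
    proof eventually_elim
      case (elim \<epsilon>)
      define k where "k = entropic_kernel c \<epsilon> \<mu> \<mu>"
      define k' where "k' = entropic_kernel c \<epsilon> \<nu> \<nu>"
      have \<epsilon>: "0 < \<epsilon>" "\<epsilon> \<le> exp (- 1)"
        using elim(1) by auto
      have "\<epsilon> \<le> 1"
        using \<epsilon>(2) by (rule order_trans) simp
      then have log: "0 \<le> ln (1 / \<epsilon>)"
        using \<epsilon>(1) by simp
      have k: "concentrated_kernel \<mu> c \<epsilon> A k"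
        unfolding k_def by (rule concentrated_kernel_mono[OF elim(2) A(2) log])
      have k': "concentrated_kernel \<nu> c \<epsilon> A k'"
        unfolding k'_def by (rule concentrated_kernel_mono[OF elim(3) A(3) log])
      have density_eq: "entropic_density c \<mu> \<nu> \<pi> \<epsilon> x y
          = (\<integral>(x', y'). t x' y' * (k x x' * k' y y') \<partial>(\<mu> \<Otimes>\<^sub>M \<nu>))" for x y
      proof -
        have "continuous_on UNIV (\<lambda>q :: 'a \<times> 'a. k x (fst q) * k' y (snd q))"
          using continuous_on_compose2[OF concentrated_kernelD(2)[OF k] continuous_on_fst[OF continuous_on_id], of UNIV]
            continuous_on_compose2[OF concentrated_kernelD(2)[OF k'] continuous_on_snd[OF continuous_on_id], of UNIV]
          by (intro continuous_on_mult) simp_all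
        then have "(\<lambda>q. k x (fst q) * k' y (snd q)) \<in> borel_measurable (\<mu> \<Otimes>\<^sub>M \<nu>)"
          unfolding measurable_cong_sets[OF sets_P refl] by (rule borel_measurable_continuous_onI)
        from integral_density[OF this t_meas dens(2)]
        have "(\<integral>q. k x (fst q) * k' y (snd q) \<partial>\<pi>)
            = (\<integral>q. (case q of (x', y') \<Rightarrow> t x' y') *\<^sub>R (k x (fst q) * k' y (snd q)) \<partial>(\<mu> \<Otimes>\<^sub>M \<nu>))"
          using dens(1) by simp
        then show ?thesis
          unfolding entropic_density_def k_def[symmetric] k'_def[symmetric] concentrated_kernelD(4)[OF k', of _ y]
          by (simp add: case_prod_unfold)
      qed
      have close: "\<bar>entropic_density c \<mu> \<nu> \<pi> \<epsilon> x y - t x y\<bar> \<le> M * (\<epsilon> * ln (1 / \<epsilon>)) powr l"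
        if "x \<in> spt \<mu>" "y \<in> spt \<nu>" for x y
        unfolding density_eq M_def
        by (rule smoothing_error[OF comp assms(2,3) t_cont t_mod c_nonneg cm L \<open>l > 0\<close> \<epsilon> A(1) k k' that])
      have \<tau>: "(\<lambda>(x, y). entropic_density c \<mu> \<nu> \<pi> \<epsilon> x y) \<in> borel_measurable (\<mu> \<Otimes>\<^sub>M \<nu>)"
        using entropic_density_measurable[OF sets \<pi>_bp] concentrated_kernelD(1)[OF k] concentrated_kernelD(1)[OF k']
        unfolding k_def k'_def by blast
      have r: "0 \<le> M * (\<epsilon> * ln (1 / \<epsilon>)) powr l"
        using M by simp
      show ?case
        using close operator_difference_hilbert_schmidt[OF assms(2,3) t_meas \<tau> t_bound t_nonneg \<pi>_eq close r]
        by blast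
    qed
  qed
qed

end
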